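(* For complex $k, a, m$, $$\int_0^{\pi } e^{-2 i x} \cot (x) \left(\Phi \left(e^{-2 (m+i x)},-k,a\right)-e^{4 i x} \Phi \left(e^{-2 m+2 i x},-k,a\right)\right) dx=-2 i \pi\, \Phi \left(e^{-2 m},-k,a\right).$$
   Context: $\Phi(z,s,v)$ is the Hurwitz–Lerch zeta function as in the NIST Digital Library of Mathematical Functions: $\Phi(z,s,v)=\sum_{n=0}^{\infty}\frac{z^n}{(n+v)^s}$ for $|z|<1$, and also for $|z|=1$ when $\mathrm{Re}\,s>1$; for other values of $z$ it is defined by analytic continuation. The variables $k, a, m$ range over the complex plane (with $a$ such that the function $\Phi$ is defined).
   Formalization: Claimed only for Re m > 0, or Re m = 0 with Re k < -1 if e^{-2m} = 1, Re k < 1 if e^{-2m} = -1, and Re k < 0 otherwise; elsewhere the identity fails (e.g. k = 0, a = 1, e^{-2m} = -2) or one of its sides is undefined. *)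

theory Defs
  imports "HOL-Complex_Analysis.Complex_Analysis" "HOL-Library.Nonpos_Ints"
begin

text \<open>
  Powers are principal powers. Isabelle has \<open>0 powr 0 = 0\<close>, so the convention \<open>x ^ 0 = 1\<close>
  is restored by hand; for \<open>s = -1, -2, \<dots>\<close> and \<open>n + v = 0\<close> the summand is \<open>0\<close>, as it should be.
\<close>
definition lerch_series :: "complex \<Rightarrow> complex \<Rightarrow> complex \<Rightarrow> complex" where
  "lerch_series z s v =
     (\<Sum>n. z ^ n / (if s = 0 then 1 else (of_nat n + v) powr s))"

text \<open>
  As in the DLMF, \<open>v\<close> is arbitrary if \<open>s\<close> is a non-positive integer, and otherwise
  \<open>v \<noteq> 0, -1, -2, \<dots>\<close>. The DLMF's further restriction to \<open>\<bar>ph v\<bar> < \<pi>\<close> for non-integer \<open>s\<close> is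
  not needed with principal powers.
\<close>
definition lerch_params :: "complex \<Rightarrow> complex \<Rightarrow> bool" where
  "lerch_params s v \<longleftrightarrow> v \<notin> \<int>\<^sub>\<le>\<^sub>0 \<or> s \<in> \<int>\<^sub>\<le>\<^sub>0"

text \<open>
  The analytic continuation in \<open>z\<close> is the principal branch, on the plane cut along \<open>[1, \<infinity>)\<close>.
  On the cut itself the value is unspecified (except at \<open>z = 1\<close> when \<open>Re s > 1\<close>).
\<close>
definition hurwitz_lerch :: "complex \<Rightarrow> complex \<Rightarrow> complex \<Rightarrow> complex" where
  "hurwitz_lerch z s v =
     (if norm z < 1 \<or> (norm z = 1 \<and> Re s > 1) then lerch_series z s v
      else (THE w. \<exists>f. f holomorphic_on (- complex_of_real ` {1..}) \<and>
                       (\<forall>u. norm u < 1 \<longrightarrow> f u = lerch_series u s v) \<and> f z = w))"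

end

theory Submission
  imports Defs "HOL-Real_Asymp.Real_Asymp"
begin

text \<open>
  Put \<open>q = exp (- 2 m)\<close>, \<open>s = - k\<close> and \<open>\<Phi>(z) = \<Phi>(z,s,a)\<close>. If \<open>\<Phi>(z)\<close> is given by a series
  \<open>\<Sum>n. c\<^sub>n z\<^sup>n\<close> at all points involved, the exponentials in the integrand combine to sines and the
  integrand becomes \<open>- 2 \<i> (\<Sum>n. c\<^sub>n q\<^sup>n cot x sin (2 (n + 1) x))\<close>. Each \<open>cot x sin (2 (n + 1) x)\<close>
  has integral \<open>\<pi>\<close> over \<open>[0, \<pi>]\<close>, because consecutive ones differ by a sum of two cosines of mean
  zero. This gives the formula as soon as sum and integral may be interchanged
  (\<open>has_integral_cot_fourier_series\<close>). Near the poles of \<open>cot\<close> the terms grow with \<open>n\<close>, but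
  \<open>\<bar>cot x sin (N x)\<bar> \<le> N\<^sup>e \<bar>sin x\<bar> powr (e - 1)\<close> for every \<open>e \<in> [0, 1]\<close>; so it suffices that
  \<open>\<Sum>n. \<bar>c\<^sub>n\<bar> \<bar>q\<bar>\<^sup>n (n + 1)\<^sup>e\<close> converges for some \<open>e > 0\<close>. Since \<open>c\<^sub>n = O(n powr (- Re s))\<close>, that settles
  \<open>\<bar>q\<bar> < 1\<close>, and also \<open>\<bar>q\<bar> = 1\<close> with \<open>Re s > 1\<close>.

  In the remaining case, \<open>\<bar>q\<bar> = 1\<close>, \<open>q \<noteq> 1\<close> and \<open>- 1 < Re s \<le> 1\<close>, the values of \<open>\<Phi>\<close> on the unit
  circle are those of its continuation to the plane cut along \<open>[1, \<infinity>)\<close>. For \<open>Re v > 0\<close> this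
  continuation is the integral
  \<open>\<Phi>(z,s,v) = 1 / \<Gamma>(s+1) \<integral> t\<^sup>s e\<^sup>-\<^sup>v\<^sup>t (\<Sum>n. (n + v) (z e\<^sup>-\<^sup>t)\<^sup>n) dt\<close> over \<open>t > 0\<close>, with the inner series
  summed in closed form; the general \<open>v\<close> is reduced to this by splitting off finitely many terms.
  Using \<open>\<Gamma>(s+1)\<close> in place of the classical \<open>\<Gamma>(s)\<close> is what makes the range \<open>Re s > - 1\<close> accessible. The
  same integral shows that \<open>\<Phi>\<close> is at most of order \<open>\<bar>1 - z\<bar>\<^sup>-\<^sup>p\<close> near \<open>z = 1\<close>, for each positive
  \<open>p < 2\<close> with \<open>p > 1 - Re s\<close>, uniformly along radii (\<open>lerch_series_continuation\<close>).

  The formula holds for \<open>r q\<close> with \<open>r < 1\<close>, and the limit \<open>r \<rightarrow> 1\<close> is taken by dominated convergence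
  (\<open>has_integral_cot_boundary\<close>). Two kinds of singularities have to be dominated. At the
  poles of \<open>cot\<close> the difference of the two \<open>\<Phi>\<close>-terms vanishes to first order, uniformly in \<open>r\<close>, since
  both arguments tend to \<open>r q\<close> and stay away from the singular point \<open>1\<close>. At the points
  where an argument reaches \<open>1\<close> the singularity \<open>\<bar>1 - z\<bar>\<^sup>-\<^sup>p\<close> is integrable if \<open>p < 1\<close>, which can be
  arranged when \<open>Re s > 0\<close>. For \<open>q = - 1\<close> such a point is \<open>x = \<pi>/2\<close>, where \<open>cot\<close> vanishes; the extra
  factor allows \<open>p < 2\<close> and hence \<open>Re s > - 1\<close>.
\<close>

section \<open>The trigonometric integrals\<close>

lemma abs_sin_powr_integrable_half_period:
  fixes p :: real
  assumes "0 \<le> p" "p < 1"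
  shows "(\<lambda>x. \<bar>sin x\<bar> powr (- p)) integrable_on {0..pi/2}"
proof (rule measurable_bounded_by_integrable_imp_integrable_real)
  show "(\<lambda>x. \<bar>sin x\<bar> powr (- p)) \<in> borel_measurable (lebesgue_on {0..pi/2})"
    by (simp add: borel_measurable_if_lebesgue_on measurable_completion measurable_restrict_space1)
  have "(\<lambda>x. x powr (- p)) integrable_on {0..pi/2}"
    using assms by (intro integrable_on_powr_from_0) auto
  then show "(\<lambda>x. (pi/2) powr p * x powr (- p)) integrable_on {0..pi/2}"
    by simp
  fix x :: real assume x: "x \<in> {0..pi/2}"
  show "\<bar>\<bar>sin x\<bar> powr (- p)\<bar> \<le> (pi/2) powr p * x powr (- p)"
  proof (cases "x = 0")
    case False
    then have x0: "0 < x" "x \<le> pi/2" using x by auto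
    \<comment> \<open>the sine is concave and lies above its chord over \<open>[0, \<pi>/2]\<close>\<close>
    have conv: "convex_on {0..pi} (\<lambda>x. - sin x)"
    proof (rule convex_on_realI)
      show "((\<lambda>x. - sin x) has_real_derivative - cos x) (at x)" for x :: real
        by (auto intro!: derivative_eq_intros)
      show "- cos x \<le> - cos y" if "x \<in> {0..pi}" "y \<in> {0..pi}" "x \<le> y" for x y :: real
        using that cos_monotone_0_pi_le[of x y] by auto
    qed auto
    define t where "t = (2/pi) * x"
    have t: "0 \<le> t" "t \<le> 1" "x = t * (pi/2)"
      using x0 by (auto simp: t_def field_simps)
    have "- sin ((1 - t) *\<^sub>R 0 + t *\<^sub>R (pi/2)) \<le> (1 - t) * (- sin 0) + t * (- sin (pi/2))"
      by (rule convex_onD[OF conv]) (use t in auto)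
    then have "t \<le> sin (t * (pi/2))" by simp
    then have "(2/pi) * x \<le> sin x"
      by (simp only: t(3)[symmetric] t_def[symmetric])
    then have "\<bar>sin x\<bar> powr (- p) \<le> ((2/pi) * x) powr (- p)"
      using x0 assms by (intro powr_mono2') auto
    also have "\<dots> = (pi/2) powr p * x powr (- p)"
      using x0 by (simp add: powr_mult powr_divide powr_minus field_simps)
    finally show ?thesis by simp
  qed simp
qed auto


text \<open>
  Periodicity and reflection reduce a power singularity at any zero of the shifted sine to the one
  at the left end of the half period.
\<close>
lemma abs_sin_powr_integrable:
  fixes p c :: real
  assumes p: "0 \<le> p" "p < 1"
  shows "(\<lambda>x. \<bar>sin (x + c)\<bar> powr (- p)) integrable_on {0..pi}"
proof -
  let ?f = "\<lambda>x. \<bar>sin x\<bar> powr (- p)"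
  have refl: "?f integrable_on {-b..-a} \<longleftrightarrow> ?f integrable_on {a..b}" for a b
    using Henstock_Kurzweil_Integration.integrable_reflect_real[where f = ?f and a = a and b = b]
    by (simp only: sin_minus abs_minus_cancel)
  have shift: "?f integrable_on {a + pi..b + pi} \<longleftrightarrow> ?f integrable_on {a..b}" for a b
    using integrable_on_shift_Icc_real[where f = ?f and c = pi and a = a and b = b] by (simp add: o_def sin_add)
  have h: "?f integrable_on {0..pi/2}"
    by (rule abs_sin_powr_integrable_half_period[OF p])
  then have "?f integrable_on {-(pi/2)..0}"
    using refl[where a = 0 and b = "pi/2"] by simp
  then have "?f integrable_on {pi/2..pi}"
    using shift[of "-(pi/2)" 0] by simp
  then have pos: "?f integrable_on {0..pi}"
    using h by (intro Henstock_Kurzweil_Integration.integrable_combine[of 0 "pi/2" pi]) auto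
  then have "?f integrable_on {-pi..0}"
    using refl[where a = 0 and b = pi] by simp
  with shift[of 0 pi] pos have "?f integrable_on {0..pi + pi}"
    by (intro Henstock_Kurzweil_Integration.integrable_combine[of 0 pi "pi + pi"]) auto
  \<comment> \<open>replace the shift \<open>c\<close> by its residue \<open>d\<close> modulo \<open>\<pi>\<close>\<close>
  define n where "n = \<lfloor>c / pi\<rfloor>"
  define d where "d = c - of_int n * pi"
  have "of_int n \<le> c / pi" "c / pi < of_int n + 1" unfolding n_def by linarith+
  then have d: "0 \<le> d" "d \<le> pi"
    unfolding d_def by (auto simp: field_simps)
  have "?f integrable_on {d..pi + d}"
    by (rule integrable_subinterval_real[OF \<open>?f integrable_on {0..pi + pi}\<close>]) (use d in auto)
  then have "(\<lambda>x. ?f (x + d)) integrable_on {0..pi}"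
    using integrable_on_shift_Icc_real[where f = ?f and c = d and a = 0 and b = pi] by (simp add: o_def add.commute)
  moreover have "\<bar>sin (x + d)\<bar> = \<bar>sin (x + c)\<bar>" for x
  proof -
    have "sin (x + d) = sin (x + c) * cos (of_int n * pi) - cos (x + c) * sin (of_int n * pi)"
      unfolding d_def by (metis add_diff_eq sin_diff)
    also have "sin (of_int n * pi) = 0"
      by (simp add: sin_zero_iff_int2)
    finally have "sin (x + d) = sin (x + c) * cos (of_int n * pi)" by simp
    moreover have "\<bar>cos (of_int n * pi)\<bar> = 1"
      using \<open>sin (of_int n * pi) = 0\<close> by (simp add: sin_zero_abs_cos_one)
    ultimately show ?thesis by (simp add: abs_mult)
  qed
  ultimately show ?thesis by simp
qed

lemma has_integral_cos_even_multiple: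
  fixes j :: nat
  assumes "j \<ge> 1"
  shows "((\<lambda>x. cos (2 * real j * x)) has_integral 0) {0..pi}"
proof -
  have "((\<lambda>x. cos (2 * real j * x)) has_integral
          (sin (2 * real j * pi) / (2 * real j) - sin (2 * real j * 0) / (2 * real j))) {0..pi}"
    using assms
    by (intro fundamental_theorem_of_calculus)
       (auto intro!: derivative_eq_intros simp: has_real_derivative_iff_has_vector_derivative[symmetric])
  moreover have "sin (2 * real j * pi) = 0"
    using sin_npi[of "2 * j"] by simp
  ultimately show ?thesis by simp
qed

text \<open>
  Induction on \<open>n\<close>: by the addition theorem, the step from \<open>n\<close> to \<open>n + 1\<close> adds
  \<open>2 cos x cos ((2 n + 3) x)\<close>, a sum of two cosines of mean zero.
\<close>
lemma has_integral_cot_sin: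
  "((\<lambda>x. cot x * sin (2 * real (Suc n) * x)) has_integral pi) {0..pi}"
proof (induction n)
  case 0
  have "((\<lambda>x. 1 + cos (2 * real 1 * x)) has_integral pi + 0) {0..pi}"
    using has_integral_const_real[of "1::real" 0 pi] has_integral_cos_even_multiple[of 1]
    by (intro has_integral_add) auto
  then have "((\<lambda>x. 1 + cos (2 * x)) has_integral pi) {0..pi}" by simp
  then show ?case
  proof (rule has_integral_spike_finite[rotated 2])
    fix x :: real assume "x \<in> {0..pi} - {0, pi}"
    then have "sin x \<noteq> 0" using sin_gt_zero[of x] by auto
    then show "cot x * sin (2 * real (Suc 0) * x) = 1 + cos (2 * x)"
      by (simp add: cot_def sin_double cos_double_cos power2_eq_square)
  qed auto
next
  case (Suc n)
  have "((\<lambda>x. cot x * sin (2 * real (Suc n) * x)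
             + (cos (2 * real (Suc (Suc n)) * x) + cos (2 * real (Suc n) * x)))
          has_integral pi + (0 + 0)) {0..pi}"
    by (intro has_integral_add Suc has_integral_cos_even_multiple) auto
  then have "((\<lambda>x. cot x * sin (2 * real (Suc n) * x)
             + (cos (2 * real (Suc (Suc n)) * x) + cos (2 * real (Suc n) * x)))
          has_integral pi) {0..pi}" by simp
  then show ?case
  proof (rule has_integral_spike_finite[rotated 2])
    fix x :: real assume "x \<in> {0..pi} - {0, pi}"
    then have s: "sin x \<noteq> 0" using sin_gt_zero[of x] by auto
    define y where "y = (2 * real n + 3) * x"
    have e: "2 * real (Suc (Suc n)) * x = y + x" "2 * real (Suc n) * x = y - x"
      by (auto simp: y_def algebra_simps)
    show "cot x * sin (2 * real (Suc (Suc n)) * x) = cot x * sin (2 * real (Suc n) * x)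
             + (cos (2 * real (Suc (Suc n)) * x) + cos (2 * real (Suc n) * x))"
      unfolding e using s by (simp add: cot_def sin_add sin_diff cos_add cos_diff field_simps)
  qed auto
qed

lemma abs_sin_multiple_le: "\<bar>sin (real n * x)\<bar> \<le> real n * \<bar>sin x\<bar>"
proof (induction n)
  case (Suc n)
  have "\<bar>sin (real (Suc n) * x)\<bar> \<le> \<bar>sin (real n * x)\<bar> * \<bar>cos x\<bar> + \<bar>cos (real n * x)\<bar> * \<bar>sin x\<bar>"
    by (simp add: algebra_simps sin_add) (metis abs_mult abs_triangle_ineq mult.commute)
  also have "\<dots> \<le> \<bar>sin (real n * x)\<bar> * 1 + 1 * \<bar>sin x\<bar>"
    by (intro add_mono mult_mono) auto
  finally show ?case using Suc by (simp add: algebra_simps)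
qed simp

text \<open>
  This interpolates between the bounds \<open>1\<close> and \<open>n \<bar>sin x\<bar>\<close> for \<open>\<bar>sin (n x)\<bar>\<close>. For \<open>e > 0\<close> the right-hand
  side is integrable in \<open>x\<close>, and only the factor \<open>n\<^sup>e\<close> has to be paid for it, instead of the factor
  \<open>n\<close> of a pointwise bound.
\<close>
lemma abs_cot_sin_le:
  fixes e x :: real
  assumes "0 \<le> e" "e \<le> 1"
  shows "\<bar>cot x * sin (real n * x)\<bar> \<le> real n powr e * \<bar>sin x\<bar> powr (- (1 - e))"
proof (cases "sin x = 0 \<or> n = 0")
  case True
  then show ?thesis by (auto simp: cot_def)
next
  case False
  then have s: "\<bar>sin x\<bar> > 0" and n: "real n > 0" by auto
  have "\<bar>sin (real n * x)\<bar> \<le> (real n * \<bar>sin x\<bar>) powr e"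
  proof (cases "real n * \<bar>sin x\<bar> \<le> 1")
    case True
    have "\<bar>sin (real n * x)\<bar> \<le> real n * \<bar>sin x\<bar>" by (rule abs_sin_multiple_le)
    also have "\<dots> = (real n * \<bar>sin x\<bar>) powr 1" using s n by simp
    also have "\<dots> \<le> (real n * \<bar>sin x\<bar>) powr e"
      using True s n assms by (intro powr_mono') auto
    finally show ?thesis .
  next
    case False
    then have "1 \<le> (real n * \<bar>sin x\<bar>) powr e"
      using assms by (intro ge_one_powr_ge_zero) auto
    then show ?thesis using abs_sin_le_one order_trans by blast
  qed
  then have "\<bar>cos x\<bar> * \<bar>sin (real n * x)\<bar> \<le> 1 * (real n * \<bar>sin x\<bar>) powr e"
    by (intro mult_mono) auto
  then have "\<bar>cot x * sin (real n * x)\<bar> \<le> (real n * \<bar>sin x\<bar>) powr e / \<bar>sin x\<bar>"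
    using s by (simp add: cot_def abs_mult divide_right_mono)
  also have "\<dots> = real n powr e * \<bar>sin x\<bar> powr (e - 1)"
    using s n by (simp add: powr_mult powr_diff)
  finally show ?thesis by simp
qed

text \<open>
  The term-by-term integration behind the whole result. The summability assumption is the
  one under which \<open>abs_cot_sin_le\<close> yields an integrable majorant of the partial sums. It
  is stated for an arbitrary weight exponent because on the unit circle only small ones are
  available.
\<close>
lemma has_integral_cot_fourier_series:
  fixes c :: "nat \<Rightarrow> complex" and e :: real
  assumes e: "0 < e" "e \<le> 1" and summ: "summable (\<lambda>n. norm (c n) * real (Suc n) powr e)"
  shows "((\<lambda>x::real. exp (- 2 * \<i> * of_real x) * of_real (cot x) *
            ((\<Sum>n. c n * exp (- 2 * \<i> * of_real x) ^ n)
             - exp (4 * \<i> * of_real x) * (\<Sum>n. c n * exp (2 * \<i> * of_real x) ^ n)))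
          has_integral (- 2 * \<i> * of_real pi * (\<Sum>n. c n))) {0..pi}"
proof -
  have norm_c: "summable (\<lambda>n. norm (c n))"
  proof (rule summable_comparison_test'[OF summ])
    fix n :: nat
    have "1 \<le> real (Suc n) powr e" using e by (intro ge_one_powr_ge_zero) auto
    then show "norm (norm (c n)) \<le> norm (c n) * real (Suc n) powr e"
      by (simp add: mult_le_cancel_left1)
  qed
  define g where "g = (\<lambda>n x. -2 * \<i> * c n * of_real (cot x * sin (2 * real (Suc n) * x)))"
  define B where "B = (\<Sum>n. 2 * norm (c n) * real (2 * Suc n) powr e)"
  have summB: "summable (\<lambda>n. 2 * norm (c n) * real (2 * Suc n) powr e)"
  proof -
    have "(\<lambda>n. 2 * norm (c n) * real (2 * Suc n) powr e)
        = (\<lambda>n. (2 * 2 powr e) * (norm (c n) * real (Suc n) powr e))"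
    proof
      fix n
      have "real (2 * Suc n) powr e = 2 powr e * real (Suc n) powr e"
        by (simp only: of_nat_mult powr_mult of_nat_numeral)
      then show "2 * norm (c n) * real (2 * Suc n) powr e
          = (2 * 2 powr e) * (norm (c n) * real (Suc n) powr e)" by simp
    qed
    then show ?thesis by (simp only: summable_mult[OF summ])
  qed
  have g_le: "norm (g n x) \<le> (2 * norm (c n) * real (2 * Suc n) powr e) * \<bar>sin x\<bar> powr (- (1 - e))" for n x
  proof -
    have "norm (g n x) = 2 * norm (c n) * \<bar>cot x * sin (real (2 * Suc n) * x)\<bar>"
      unfolding g_def norm_mult norm_of_real by simp
    also have "\<dots> \<le> 2 * norm (c n) * (real (2 * Suc n) powr e * \<bar>sin x\<bar> powr (- (1 - e)))"
      using e by (intro mult_left_mono abs_cot_sin_le) auto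
    finally show ?thesis by (simp only: mult.assoc)
  qed
  have "((\<lambda>x. \<Sum>n. g n x) has_integral (- 2 * \<i> * of_real pi * (\<Sum>n. c n))) {0..pi}"
  proof (rule has_integral_dominated_convergence)
    show "((\<lambda>x. \<Sum>n<N. g n x) has_integral (\<Sum>n<N. -2 * \<i> * c n * of_real pi)) {0..pi}" for N
      unfolding g_def
      by (intro has_integral_sum has_integral_mult_right has_integral_of_real has_integral_cot_sin) auto
    show "(\<lambda>x. B * \<bar>sin x\<bar> powr (- (1 - e))) integrable_on {0..pi}"
      using abs_sin_powr_integrable[of "1 - e" 0] e by (intro integrable_on_mult_right) auto
    show "\<forall>x\<in>{0..pi}. norm (\<Sum>n<N. g n x) \<le> B * \<bar>sin x\<bar> powr (- (1 - e))" for N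
    proof
      fix x
      have "norm (\<Sum>n<N. g n x)
          \<le> (\<Sum>n<N. 2 * norm (c n) * real (2 * Suc n) powr e * \<bar>sin x\<bar> powr (- (1 - e)))"
        by (intro sum_norm_le g_le)
      also have "\<dots> = (\<Sum>n<N. 2 * norm (c n) * real (2 * Suc n) powr e) * \<bar>sin x\<bar> powr (- (1 - e))"
        by (simp only: sum_distrib_right)
      also have "\<dots> \<le> B * \<bar>sin x\<bar> powr (- (1 - e))"
        unfolding B_def by (intro mult_right_mono sum_le_suminf summB) auto
      finally show "norm (\<Sum>n<N. g n x) \<le> B * \<bar>sin x\<bar> powr (- (1 - e))" .
    qed
    show "\<forall>x\<in>{0..pi}. (\<lambda>N. \<Sum>n<N. g n x) \<longlonglongrightarrow> (\<Sum>n. g n x)"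
    proof
      fix x
      have "summable (\<lambda>n. 2 * norm (c n) * real (2 * Suc n) powr e * \<bar>sin x\<bar> powr (- (1 - e)))"
        by (intro summable_mult2 summB)
      then have "summable (\<lambda>n. g n x)"
        by (rule summable_comparison_test') (rule g_le)
      then show "(\<lambda>N. \<Sum>n<N. g n x) \<longlonglongrightarrow> (\<Sum>n. g n x)"
        by (rule summable_LIMSEQ)
    qed
    have "(\<lambda>N. - 2 * \<i> * of_real pi * (\<Sum>n<N. c n)) \<longlonglongrightarrow> - 2 * \<i> * of_real pi * (\<Sum>n. c n)"
      by (intro tendsto_intros summable_LIMSEQ summable_norm_cancel[OF norm_c])
    then show "(\<lambda>N. \<Sum>n<N. - 2 * \<i> * c n * of_real pi) \<longlonglongrightarrow> - 2 * \<i> * of_real pi * (\<Sum>n. c n)"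
      by (simp add: sum_distrib_left sum_negf mult_ac)
  qed
  moreover have "(\<Sum>n. g n x) = exp (- 2 * \<i> * of_real x) * of_real (cot x) *
            ((\<Sum>n. c n * exp (- 2 * \<i> * of_real x) ^ n)
             - exp (4 * \<i> * of_real x) * (\<Sum>n. c n * exp (2 * \<i> * of_real x) ^ n))" for x
  proof -
    define u where "u = exp (2 * \<i> * complex_of_real x)"
    have u: "exp (- 2 * \<i> * of_real x) = inverse u" "exp (4 * \<i> * of_real x) = u ^ 2" "u \<noteq> 0"
      by (auto simp: u_def exp_minus[symmetric] exp_of_nat_mult[symmetric] mult.assoc)
    have nu: "norm u = 1" by (simp add: u_def)
    have s: "summable (\<lambda>n. c n * inverse u ^ n)" "summable (\<lambda>n. c n * u ^ n)"
      by (rule summable_norm_cancel, simp add: norm_mult norm_power norm_inverse nu norm_c)+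
    have reorder: "- 2 * \<i> * C * (K * S) = - C * K * (2 * \<i> * S)" for C K S :: complex
      by (simp add: mult_ac)
    have g: "g n x = inverse u * of_real (cot x) * (c n * inverse u ^ n - u ^ 2 * (c n * u ^ n))" for n
    proof -
      have "u ^ Suc n - inverse u ^ Suc n = 2 * \<i> * of_real (sin (2 * real (Suc n) * x))"
      proof -
        have "u ^ Suc n = exp (of_nat (Suc n) * (2 * \<i> * of_real x))"
          unfolding u_def exp_of_nat_mult ..
        also have "of_nat (Suc n) * (2 * \<i> * of_real x) = \<i> * of_real (2 * real (Suc n) * x)"
          by simp
        finally have "u ^ Suc n = exp (\<i> * of_real (2 * real (Suc n) * x))" .
        then show ?thesis
          unfolding sin_of_real[symmetric] sin_exp_eq power_inverse exp_minus by simp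
      qed
      then have "g n x = - c n * of_real (cot x) * (u ^ Suc n - inverse u ^ Suc n)"
        unfolding g_def of_real_mult by (simp only:) (rule reorder)
      also have "\<dots> = inverse u * of_real (cot x) * (c n * inverse u ^ n - u ^ 2 * (c n * u ^ n))"
      proof -
        have expand: "I * K * (C * P - U * (C * Q)) = - C * K * ((I * U) * Q - I * P)" for I K C P Q U :: complex
          by (simp add: algebra_simps)
        have "inverse u * u ^ 2 = u" using u(3) by (simp add: power2_eq_square)
        then show ?thesis by (simp only: expand power_Suc)
      qed
      finally show ?thesis .
    qed
    have "(\<Sum>n. g n x) = inverse u * of_real (cot x) *
        ((\<Sum>n. c n * inverse u ^ n) - u ^ 2 * (\<Sum>n. c n * u ^ n))"
      unfolding g using s
      by (intro sums_unique[symmetric] sums_mult sums_diff summable_sums)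
    then show ?thesis by (simp only: u u_def[symmetric])
  qed
  ultimately show ?thesis by simp
qed

text \<open>
  Inside the disc a power series converges geometrically, so the weight exponent \<open>1\<close> will do.
\<close>
lemma has_integral_cot_inside_disc:
  assumes f: "f holomorphic_on ball 0 1" and q: "norm q < 1"
  shows "((\<lambda>x::real. exp (- 2 * \<i> * of_real x) * of_real (cot x) *
            (f (q * exp (- 2 * \<i> * of_real x))
             - exp (4 * \<i> * of_real x) * f (q * exp (2 * \<i> * of_real x))))
          has_integral (- 2 * \<i> * of_real pi * f q)) {0..pi}"
proof -
  define a where "a = (\<lambda>n. (deriv ^^ n) f 0 / fact n)"
  have a: "(\<lambda>n. a n * z ^ n) sums f z" if "norm z < 1" for z
    using holomorphic_power_series[OF f, of z] that by (simp add: a_def)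
  have f_eq: "f (q * w) = (\<Sum>n. (a n * q ^ n) * w ^ n)" if "norm w = 1" for w
    using a[of "q * w"] q that by (simp add: sums_iff power_mult_distrib norm_mult mult.assoc)
  have "summable (\<lambda>n. norm (a n * q ^ n) * real (Suc n) powr 1)"
  proof -
    obtain \<rho> where \<rho>: "norm q < \<rho>" "\<rho> < 1" using q dense by blast
    \<comment> \<open>the coefficients of \<open>z f(z)\<close>: differentiating produces the weight \<open>n + 1\<close>\<close>
    let ?b = "\<lambda>n. case n of 0 \<Rightarrow> 0 | Suc k \<Rightarrow> a k"
    have "summable (\<lambda>n. ?b n * z ^ n)" if "norm z < 1" for z
    proof -
      have "summable (\<lambda>n. z * (a n * z ^ n))"
        using a[OF that] sums_summable summable_mult by blast
      then have "summable (\<lambda>n. ?b (Suc n) * z ^ Suc n)" by (simp add: mult_ac)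
      then show ?thesis by (subst (asm) summable_Suc_iff)
    qed
    then have "summable (\<lambda>n. diffs ?b n * complex_of_real \<rho> ^ n)"
      using \<rho> norm_ge_zero[of q] by (intro termdiff_converges[where K = 1]) (auto simp del: norm_ge_zero)
    then have "summable (\<lambda>n. norm (diffs ?b n * q ^ n))"
      using \<rho> norm_ge_zero[of q] by (intro powser_insidea) (auto simp del: norm_ge_zero)
    moreover have "norm (diffs ?b n * q ^ n) = norm (a n * q ^ n) * real (Suc n) powr 1" for n
      by (simp add: diffs_def norm_mult del: of_nat_Suc)
    ultimately show ?thesis by simp
  qed
  from has_integral_cot_fourier_series[OF _ _ this]
  have "((\<lambda>x::real. exp (- 2 * \<i> * of_real x) * of_real (cot x) *
            ((\<Sum>n. (a n * q ^ n) * exp (- 2 * \<i> * of_real x) ^ n)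
             - exp (4 * \<i> * of_real x) * (\<Sum>n. (a n * q ^ n) * exp (2 * \<i> * of_real x) ^ n)))
          has_integral (- 2 * \<i> * of_real pi * (\<Sum>n. a n * q ^ n))) {0..pi}"
    by simp
  moreover have "(\<Sum>n. (a n * q ^ n) * exp (- 2 * \<i> * of_real x) ^ n) = f (q * exp (- 2 * \<i> * of_real x))"
    "(\<Sum>n. (a n * q ^ n) * exp (2 * \<i> * of_real x) ^ n) = f (q * exp (2 * \<i> * of_real x))" for x :: real
    by (intro f_eq[symmetric]; simp)+
  moreover have "(\<Sum>n. a n * q ^ n) = f q" using a[OF q] by (simp add: sums_iff)
  ultimately show ?thesis by (simp only:)
qed

section \<open>Parametric integrals and the complex Gamma integral\<close>

text \<open>
  Differentiation under the integral sign. By Cauchy's inequality a local majorant of the integrand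
  also controls its derivative, and so the difference quotients; no majorant
  for the derivative has to be supplied.
\<close>
lemma dominated_parametric_integral_holomorphic:
  fixes f :: "complex \<Rightarrow> real \<Rightarrow> complex"
  assumes "open U"
    and holo: "\<And>t. t \<in> S \<Longrightarrow> (\<lambda>z. f z t) holomorphic_on U"
    and int: "\<And>z. z \<in> U \<Longrightarrow> f z integrable_on S"
    and dom: "\<And>z. z \<in> U \<Longrightarrow> \<exists>d>0. \<exists>g. g integrable_on S \<and> (\<forall>w\<in>ball z d. \<forall>t\<in>S. norm (f w t) \<le> g t)"
  shows "(\<lambda>z. integral S (f z)) holomorphic_on U"
  unfolding holomorphic_on_open[OF \<open>open U\<close>]
proof (intro ballI)
  fix z assume "z \<in> U"
  obtain d0 g where d0: "d0 > 0" and g: "g integrable_on S"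
      and le0: "\<And>w t. w \<in> ball z d0 \<Longrightarrow> t \<in> S \<Longrightarrow> norm (f w t) \<le> g t"
    using dom[OF \<open>z \<in> U\<close>] by blast
  obtain d1 where d1: "d1 > 0" "ball z d1 \<subseteq> U"
    using \<open>open U\<close> \<open>z \<in> U\<close> open_contains_ball by blast
  define d where "d = min d0 d1 / 2"
  have d: "d > 0" "2 * d \<le> d0" "2 * d \<le> d1" using d0 d1 by (auto simp: d_def)
  have le: "norm (f w t) \<le> g t" if "w \<in> ball z (2 * d)" "t \<in> S" for w t
    using le0[of w t] that d by auto
  have sub: "ball z (2 * d) \<subseteq> U" using d d1 by auto
  have deriv_le: "norm (deriv (\<lambda>z. f z t) w) \<le> g t / d" if w: "w \<in> ball z d" and t: "t \<in> S" for w t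
  proof -
    have "cball w d \<subseteq> ball z (2 * d)"
      using w by (simp add: cball_subset_ball_iff dist_commute)
    then have cb: "cball w d \<subseteq> U" using sub by blast
    have h: "(\<lambda>z. f z t) holomorphic_on cball w d"
      using holo[OF t] cb holomorphic_on_subset by blast
    have "norm ((deriv ^^ 1) (\<lambda>z. f z t) w) \<le> fact 1 * g t / d ^ 1"
    proof (rule Cauchy_inequality)
      show "(\<lambda>z. f z t) holomorphic_on ball w d"
        using h ball_subset_cball holomorphic_on_subset by blast
      show "continuous_on (cball w d) (\<lambda>z. f z t)"
        using h by (rule holomorphic_on_imp_continuous_on)
      fix x assume "norm (w - x) = d"
      then have "x \<in> cball w d" by (simp add: dist_norm)
      then show "norm (f x t) \<le> g t"
        using \<open>cball w d \<subseteq> ball z (2 * d)\<close> le t by blast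
    qed (use d in auto)
    then show ?thesis by simp
  qed
  have diff_le: "norm (f w t - f z t) \<le> g t / d * norm (w - z)" if w: "w \<in> ball z d" and t: "t \<in> S" for w t
  proof (rule field_differentiable_bound[where S = "ball z d"])
    fix y assume y: "y \<in> ball z d"
    then have "y \<in> U" using sub d by auto
    then show "((\<lambda>z. f z t) has_field_derivative deriv (\<lambda>z. f z t) y) (at y within ball z d)"
      using holomorphic_derivI[OF holo[OF t] \<open>open U\<close>] has_field_derivative_at_within by blast
    show "norm (deriv (\<lambda>z. f z t) y) \<le> g t / d" by (rule deriv_le[OF y t])
  qed (use w d in auto)
  \<comment> \<open>the difference quotients converge along every sequence, by dominated convergence\<close>
  have "((\<lambda>w. (integral S (f w) - integral S (f z)) / (w - z)) \<longlongrightarrow>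
          integral S (\<lambda>t. deriv (\<lambda>z. f z t) z)) (at z within ball z d)"
    unfolding tendsto_at_iff_sequentially
  proof (intro allI impI)
    fix X assume X: "\<forall>i. X i \<in> ball z d - {z}" "X \<longlonglongrightarrow> z"
    have XU: "X i \<in> U" for i
      using X(1) d by (intro subsetD[OF sub]) (auto intro: less_le_trans[of _ d])
    have intX: "(\<lambda>t. (f (X i) t - f z t) / (X i - z)) integrable_on S" for i
      using integrable_diff[OF int[OF XU] int[OF \<open>z \<in> U\<close>]]
      by (simp add: divide_inverse integrable_on_mult_left)
    have "(\<lambda>i. integral S (\<lambda>t. (f (X i) t - f z t) / (X i - z))) \<longlonglongrightarrow> integral S (\<lambda>t. deriv (\<lambda>z. f z t) z)"
    proof (rule dominated_convergence)
      show "(\<lambda>t. g t / d) integrable_on S"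
        using integrable_on_mult_left[OF g, of "inverse d"] by (simp add: divide_inverse)
      fix t assume t: "t \<in> S"
      have "((\<lambda>w. (f w t - f z t) / (w - z)) \<longlongrightarrow> deriv (\<lambda>z. f z t) z) (at z)"
        using holomorphic_derivI[OF holo[OF t] \<open>open U\<close> \<open>z \<in> U\<close>] by (simp add: has_field_derivative_iff)
      then show "(\<lambda>i. (f (X i) t - f z t) / (X i - z)) \<longlonglongrightarrow> deriv (\<lambda>z. f z t) z"
        using X unfolding tendsto_at_iff_sequentially by (auto simp: o_def)
      show "norm ((f (X i) t - f z t) / (X i - z)) \<le> g t / d" for i
        using diff_le[of "X i" t] X(1) t by (auto simp: norm_divide divide_le_eq)
    qed (rule intX)
    moreover have "integral S (\<lambda>t. (f (X i) t - f z t) / (X i - z))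
        = (integral S (f (X i)) - integral S (f z)) / (X i - z)" for i
      by (simp add: integral_diff[OF int[OF XU] int[OF \<open>z \<in> U\<close>]])
    ultimately show "((\<lambda>w. (integral S (f w) - integral S (f z)) / (w - z)) \<circ> X) \<longlonglongrightarrow>
          integral S (\<lambda>t. deriv (\<lambda>z. f z t) z)"
      by (simp only: o_def)
  qed
  moreover have "at z within ball z d = at z" using d by (simp add: at_within_open[of z "ball z d"])
  ultimately show "\<exists>f'. ((\<lambda>z. integral S (f z)) has_field_derivative f') (at z)"
    by (auto simp: has_field_derivative_iff)
qed

lemma gamma_kernel_integrable:
  fixes p b :: real
  assumes "p > -1" "b > 0"
  shows "(\<lambda>t. t powr p * exp (- (b * t))) integrable_on {0<..}"
proof -
  have "(\<lambda>t. complex_of_real t powr (of_real (p + 1) - 1) / of_real (exp (b * t)))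
          absolutely_integrable_on {0<..}"
    using assms by (intro absolutely_integrable_Gamma_integral) auto
  then have "(\<lambda>t. norm (complex_of_real t powr (of_real (p + 1) - 1) / of_real (exp (b * t))))
          integrable_on {0<..}"
    unfolding absolutely_integrable_on_def by (rule conjunct2)
  then show ?thesis
    by (rule integrable_eq) (auto simp: norm_mult norm_inverse norm_powr_real_powr exp_minus divide_inverse)
qed

lemma norm_gamma_kernel:
  assumes "t > 0"
  shows "norm (complex_of_real t powr s * exp (- (v * of_real t))) = t powr Re s * exp (- (Re v * t))"
  using assms by (simp add: norm_mult norm_powr_real_powr)

lemma integrable_of_continuous_dominated:
  fixes f :: "real \<Rightarrow> complex"
  assumes "continuous_on {0<..} f" "g integrable_on {0<..}" "\<And>t. t > 0 \<Longrightarrow> norm (f t) \<le> g t"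
  shows "f integrable_on {0<..}"
  by (rule measurable_bounded_by_integrable_imp_integrable[OF _ assms(2)])
     (use assms in \<open>auto intro: continuous_imp_measurable_on_sets_lebesgue\<close>)

lemma gamma_integral_scaled_real:
  fixes s :: complex and b :: real
  assumes s: "Re s > 0" and b: "b > 0"
  shows "integral {0<..} (\<lambda>t. complex_of_real t powr (s - 1) * exp (- (of_real b * of_real t)))
           = Gamma s * of_real b powr (- s)"
proof -
  let ?f = "\<lambda>b t. indicator {0<..} t *\<^sub>R (complex_of_real t powr (s - 1) * exp (- (of_real b * of_real t)))"
  have leb: "integral {0<..} (\<lambda>t. complex_of_real t powr (s - 1) * exp (- (of_real b * of_real t)))
      = (\<integral>t. ?f b t \<partial>lborel)" if "b > 0" for b :: real
  proof -
    have "(\<lambda>t. complex_of_real t powr (s - 1) * exp (- (of_real b * of_real t)))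
            absolutely_integrable_on {0<..}"
      using absolutely_integrable_Gamma_integral[OF s that]
      by (simp add: exp_minus divide_inverse exp_of_real[symmetric])
    then have "integral {0<..} (\<lambda>t. complex_of_real t powr (s - 1) * exp (- (of_real b * of_real t)))
      = (\<integral>t. ?f b t \<partial>lebesgue)"
      by (simp add: set_lebesgue_integral_eq_integral(2)[symmetric] set_lebesgue_integral_def)
    also have "\<dots> = (\<integral>t. ?f b t \<partial>lborel)"
      by (rule integral_completion) measurable
    finally show ?thesis .
  qed
  have "(\<integral>t. ?f 1 t \<partial>lborel) = \<bar>b\<bar> *\<^sub>R (\<integral>t. ?f 1 (0 + b * t) \<partial>lborel)"
    by (rule lborel_integral_real_affine) (use b in auto)
  also have "(\<lambda>t. ?f 1 (0 + b * t)) = (\<lambda>t. of_real b powr (s - 1) * ?f b t)"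
  proof
    fix t :: real
    show "?f 1 (0 + b * t) = of_real b powr (s - 1) * ?f b t"
      using b by (cases "t > 0") (auto simp: indicator_def zero_less_mult_iff powr_times_real)
  qed
  also have "\<bar>b\<bar> *\<^sub>R (\<integral>t. of_real b powr (s - 1) * ?f b t \<partial>lborel) = of_real b powr s * (\<integral>t. ?f b t \<partial>lborel)"
    using b by (subst integral_mult_right_zero) (simp add: scaleR_conv_of_real powr_diff)
  finally have "integral {0<..} (\<lambda>t. complex_of_real t powr (s - 1) * exp (- (of_real 1 * of_real t)))
      = of_real b powr s * integral {0<..} (\<lambda>t. complex_of_real t powr (s - 1) * exp (- (of_real b * of_real t)))"
    using leb[of 1] leb[OF b] by simp
  moreover have "integral {0<..} (\<lambda>t. complex_of_real t powr (s - 1) * exp (- (of_real 1 * of_real t))) = Gamma s"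
    using integral_unique[OF Gamma_integral_complex'[OF s]]
    by (simp add: exp_minus divide_inverse exp_of_real[symmetric])
  ultimately show ?thesis using b by (simp add: powr_minus field_simps)
qed

text \<open>
  Both sides are holomorphic in the half plane \<open>Re v > 0\<close> and agree for real \<open>v\<close>, where the
  substitution \<open>t \<mapsto> v t\<close> is available.
\<close>
lemma gamma_integral_scaled:
  assumes s: "Re s > 0" and v: "Re v > 0"
  shows "((\<lambda>t. complex_of_real t powr (s - 1) * exp (- (v * of_real t))) has_integral
           Gamma s * v powr (- s)) {0<..}"
proof -
  let ?f = "\<lambda>v t. complex_of_real t powr (s - 1) * exp (- (v * of_real t))"
  let ?U = "{v. Re v > 0}"
  have op: "open ?U" by (rule open_halfspace_Re_gt)
  have int: "?f v integrable_on {0<..}" if "Re v > 0" for v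
  proof (rule integrable_of_continuous_dominated)
    show "continuous_on {0<..} (?f v)" by (auto intro!: continuous_intros)
    show "(\<lambda>t. t powr Re (s - 1) * exp (- (Re v * t))) integrable_on {0<..}"
      using s that by (intro gamma_kernel_integrable) auto
    show "norm (?f v t) \<le> t powr Re (s - 1) * exp (- (Re v * t))" if "t > 0" for t
      using norm_gamma_kernel[OF that, of "s - 1" v] by simp
  qed
  have holo: "(\<lambda>v. integral {0<..} (?f v)) holomorphic_on ?U"
  proof (rule dominated_parametric_integral_holomorphic[OF op])
    show "(\<lambda>v. ?f v t) holomorphic_on ?U" for t by (intro holomorphic_intros)
    show "?f v integrable_on {0<..}" if "v \<in> ?U" for v using int that by simp
    fix v assume v: "v \<in> ?U"
    show "\<exists>d>0. \<exists>g. g integrable_on {0<..} \<and> (\<forall>w\<in>ball v d. \<forall>t\<in>{0<..}. norm (?f w t) \<le> g t)"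
    proof (intro exI conjI ballI)
      show "Re v / 2 > 0" using v by simp
      show "(\<lambda>t. t powr Re (s - 1) * exp (- (Re v / 2 * t))) integrable_on {0<..}"
        using s v by (intro gamma_kernel_integrable) auto
      fix w and t :: real assume w: "w \<in> ball v (Re v / 2)" and t: "t \<in> {0<..}"
      have "\<bar>Re (v - w)\<bar> \<le> norm (v - w)" by (rule abs_Re_le_cmod)
      then have "Re w \<ge> Re v / 2" using w by (simp add: dist_norm)
      then have "Re v / 2 * t \<le> Re w * t" using t by (intro mult_right_mono) auto
      then have "t powr Re (s - 1) * exp (- (Re w * t)) \<le> t powr Re (s - 1) * exp (- (Re v / 2 * t))"
        by (intro mult_left_mono) auto
      then show "norm (?f w t) \<le> t powr Re (s - 1) * exp (- (Re v / 2 * t))"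
        using norm_gamma_kernel[of t "s - 1" w] t by simp
    qed
  qed
  have "integral {0<..} (?f v) - Gamma s * v powr (- s) = 0"
  proof (rule analytic_continuation[where f = "\<lambda>v. integral {0<..} (?f v) - Gamma s * v powr (- s)"])
    show "(\<lambda>v. integral {0<..} (?f v) - Gamma s * v powr (- s)) holomorphic_on ?U"
      by (intro holomorphic_intros holo) (auto simp: complex_nonpos_Reals_iff)
    show "connected ?U" by (simp add: convex_connected convex_halfspace_Re_gt)
    show "of_real ` {0<..} \<subseteq> ?U" by auto
    show "(1::complex) islimpt complex_of_real ` {0<..}"
    proof -
      have "(\<lambda>n. complex_of_real (1 + inverse (real (Suc n)))) \<longlonglongrightarrow> of_real (1 + 0)"
        by (intro tendsto_intros LIMSEQ_inverse_real_of_nat)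
      moreover have "complex_of_real (1 + inverse (real (Suc n))) \<in> of_real ` {0<..} - {1}" for n
      proof -
        have "inverse (real (Suc n)) > 0" by simp
        then have "1 + inverse (real (Suc n)) \<in> {0<..} - {1}"
          by (simp del: of_nat_Suc add: add_pos_pos)
        then show ?thesis by (metis DiffD1 DiffD2 DiffI imageI insert_iff of_real_eq_1_iff empty_iff)
      qed
      ultimately show ?thesis
        unfolding islimpt_sequential by (intro exI[of _ "\<lambda>n. complex_of_real (1 + inverse (real (Suc n)))"]) auto
    qed
    show "integral {0<..} (?f z) - Gamma s * z powr (- s) = 0" if "z \<in> of_real ` {0<..}" for z
      using that gamma_integral_scaled_real[OF s] by auto
  qed (use op v in auto)
  then show ?thesis using int[OF v] integrable_integral by fastforce
qed

section \<open>Continuation of the Lerch series to the slit_plane plane\<close>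

text \<open>
  The domain of the principal branch of the Lerch function. It is star-shaped about \<open>0\<close>
  (\<open>slit_scale\<close>), and this gives both the uniqueness of the continuation and the convergence of
  the integrals along the segments \<open>{z exp (- t)}\<close>.
\<close>
definition slit_plane :: "complex set" where "slit_plane = - complex_of_real ` {1..}"

lemma slit_iff: "z \<in> slit_plane \<longleftrightarrow> Im z \<noteq> 0 \<or> Re z < 1"
  by (force simp: slit_plane_def image_iff complex_eq_iff)

lemma open_slit: "open slit_plane"
proof -
  have "slit_plane = {z. Im z \<noteq> 0} \<union> {z. Re z < 1}" by (auto simp: slit_iff)
  moreover have "open {z. Im z \<noteq> 0}" by (intro open_Collect_neq continuous_intros)
  ultimately show ?thesis by (metis open_Un open_halfspace_Re_lt)
qed

lemma slit_scale:
  assumes "z \<in> slit_plane" "0 \<le> r" "r \<le> (1::real)"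
  shows "of_real r * z \<in> slit_plane"
proof (cases "Im z = 0 \<or> r = 0")
  case True
  then have "r * Re z < 1"
  proof
    assume "Im z = 0"
    then have "Re z < 1" using assms by (simp add: slit_iff)
    then show ?thesis
      using assms by (cases "Re z \<le> 0") (auto intro: le_less_trans[OF mult_left_le_one_le] le_less_trans[OF mult_nonneg_nonpos])
  qed simp
  then show ?thesis by (simp add: slit_iff)
qed (use assms in \<open>auto simp: slit_iff\<close>)

lemma connected_slit: "connected slit_plane"
proof (rule starlike_imp_connected, unfold starlike_def, intro bexI[of _ 0] ballI subsetI)
  fix x y assume x: "x \<in> slit_plane" and "y \<in> closed_segment 0 x"
  then obtain u :: real where "0 \<le> u" "u \<le> 1" "y = of_real u * x"
    by (auto simp: closed_segment_def scaleR_conv_of_real)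
  then show "y \<in> slit_plane" using slit_scale[OF x] by simp
qed (simp add: slit_iff)

lemma ball_subset_slit: "ball 0 1 \<subseteq> slit_plane"
proof
  fix z :: complex assume "z \<in> ball 0 1"
  then show "z \<in> slit_plane" using complex_Re_le_cmod[of z] by (auto simp: slit_iff)
qed

lemma unit_circle_in_slit: "norm z = 1 \<Longrightarrow> z \<noteq> 1 \<Longrightarrow> z \<in> slit_plane"
  using complex_Re_le_cmod[of z] by (auto simp: slit_iff complex_eq_iff cmod_def)

text \<open>
  The closed form of \<open>\<Sum>n. (n + v) u\<^sup>n\<close>, see \<open>lerch_kernel_sums\<close>.
\<close>
definition lerch_kernel :: "complex \<Rightarrow> complex \<Rightarrow> complex" where
  "lerch_kernel v u = (u + v * (1 - u)) / (1 - u) ^ 2"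

lemma lerch_kernel_sums:
  assumes "norm u < 1"
  shows "(\<lambda>n. (of_nat n + v) * u ^ n) sums lerch_kernel v u"
proof -
  have "u \<noteq> 1" using assms by auto
  have "(\<lambda>n. of_nat (Suc n) * u ^ n - u ^ n + v * u ^ n) sums (1 / (1 - u)\<^sup>2 - 1 / (1 - u) + v * (1 / (1 - u)))"
    by (intro sums_add sums_diff sums_mult geometric_deriv_sums geometric_sums assms)
  moreover have "(of_nat (Suc n) * u ^ n - u ^ n + v * u ^ n) = (of_nat n + v) * u ^ n" for n
    by (simp add: algebra_simps)
  moreover have "1 / (1 - u)\<^sup>2 - 1 / (1 - u) + v * (1 / (1 - u)) = lerch_kernel v u"
    using \<open>u \<noteq> 1\<close> by (simp add: lerch_kernel_def power2_eq_square divide_simps)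
  ultimately show ?thesis by simp
qed

lemma norm_lerch_kernel_le:
  assumes "norm u \<le> R"
  shows "norm (lerch_kernel v u) \<le> (R + norm v * (1 + R)) / norm (1 - u) ^ 2"
proof -
  have "norm (1 - u) \<le> 1 + R" using norm_triangle_ineq4[of 1 u] assms by simp
  then have "norm (u + v * (1 - u)) \<le> R + norm v * (1 + R)"
    using assms by (intro norm_triangle_le add_mono) (auto simp: norm_mult intro: mult_left_mono)
  then show ?thesis by (simp add: lerch_kernel_def norm_divide norm_power divide_right_mono)
qed

definition lerch_integrand :: "complex \<Rightarrow> complex \<Rightarrow> complex \<Rightarrow> real \<Rightarrow> complex" where
  "lerch_integrand s v z t = of_real t powr s * exp (- (v * of_real t)) * lerch_kernel v (z * of_real (exp (- t)))"

definition lerch_integral :: "complex \<Rightarrow> complex \<Rightarrow> complex \<Rightarrow> complex" where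
  "lerch_integral s v z = integral {0<..} (lerch_integrand s v z) / Gamma (s + 1)"

lemma one_notin_kernel_arg:
  assumes "z \<in> slit_plane" "t > 0"
  shows "z * of_real (exp (- t)) \<noteq> 1"
proof -
  have "of_real (exp (- t)) * z \<in> slit_plane"
    using assms by (intro slit_scale) auto
  moreover have "1 \<notin> slit_plane" by (simp add: slit_iff)
  ultimately show ?thesis by (metis mult.commute)
qed

lemma continuous_on_lerch_integrand:
  assumes "z \<in> slit_plane"
  shows "continuous_on {0<..} (lerch_integrand s v z)"
  unfolding lerch_integrand_def lerch_kernel_def
  using one_notin_kernel_arg[OF assms]
  by (intro continuous_intros) auto

lemma norm_lerch_integrand_le:
  assumes t: "t > 0" and R: "norm z \<le> R" and c: "c > 0" "c \<le> norm (1 - z * of_real (exp (- t)))"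
  shows "norm (lerch_integrand s v z t) \<le>
           (R + norm v * (1 + R)) / c ^ 2 * (t powr Re s * exp (- (Re v * t)))"
proof -
  have R0: "R \<ge> 0" using R norm_ge_zero order_trans by blast
  have "norm (z * of_real (exp (- t))) \<le> R * 1"
    unfolding norm_mult using R t R0 by (intro mult_mono) auto
  then have "norm (lerch_kernel v (z * of_real (exp (- t)))) \<le>
      (R + norm v * (1 + R)) / norm (1 - z * of_real (exp (- t))) ^ 2"
    by (intro norm_lerch_kernel_le) simp
  also have "\<dots> \<le> (R + norm v * (1 + R)) / c ^ 2"
    using R0 c by (intro divide_left_mono power_mono mult_pos_pos zero_less_power) auto
  finally have "norm (lerch_kernel v (z * of_real (exp (- t)))) * (t powr Re s * exp (- (Re v * t))) \<le>
    (R + norm v * (1 + R)) / c ^ 2 * (t powr Re s * exp (- (Re v * t)))"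
    by (intro mult_right_mono) auto
  then show ?thesis
    unfolding lerch_integrand_def norm_mult[of _ "lerch_kernel _ _"] norm_gamma_kernel[OF t]
    by (simp add: mult.commute)
qed

text \<open>
  The segments from \<open>0\<close> to the points of a small disc around \<open>z\<close> fill a compact set that misses \<open>1\<close>.
\<close>
lemma slit_locally_away_from_one:
  assumes "z \<in> slit_plane"
  shows "\<exists>d>0. \<exists>c>0. \<forall>w\<in>ball z d. \<forall>r\<in>{0..1::real}. c \<le> norm (1 - w * of_real r)"
proof -
  obtain d where d: "d > 0" "cball z d \<subseteq> slit_plane"
    using open_slit assms open_contains_cball by blast
  have "compact ((\<lambda>(w, r). w * complex_of_real r) ` (cball z d \<times> {0..1}))"
    by (intro compact_continuous_image compact_Times)
       (auto intro!: continuous_intros simp: case_prod_unfold)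
  moreover have "1 \<notin> (\<lambda>(w, r). w * complex_of_real r) ` (cball z d \<times> {0..1})"
  proof
    assume "1 \<in> (\<lambda>(w, r). w * complex_of_real r) ` (cball z d \<times> {0..1})"
    then obtain w r where w: "w \<in> cball z d" "r \<in> {0..1}" "1 = of_real r * w"
      by (auto simp: mult.commute)
    then have "of_real r * w \<in> slit_plane" using d by (intro slit_scale) auto
    then show False using w(3) by (simp add: slit_iff)
  qed
  ultimately obtain c where c: "c > 0" "\<forall>x\<in>(\<lambda>(w, r). w * complex_of_real r) ` (cball z d \<times> {0..1}). c \<le> dist 1 x"
    using separate_point_closed compact_imp_closed by meson
  then show ?thesis using d(1) by (force simp: dist_norm)
qed

lemma lerch_integrand_locally_dominated:
  assumes s: "Re s > -1" and v: "Re v > 0" and z: "z \<in> slit_plane"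
  shows "\<exists>d>0. \<exists>g. g integrable_on {0<..} \<and>
           (\<forall>w\<in>ball z d. \<forall>t\<in>{0<..}. norm (lerch_integrand s v w t) \<le> g t)"
proof -
  obtain d c where d: "d > 0" "c > 0" and away: "\<forall>w\<in>ball z d. \<forall>r\<in>{0..1::real}. c \<le> norm (1 - w * of_real r)"
    using slit_locally_away_from_one[OF z] by blast
  define R where "R = norm z + d"
  show ?thesis
  proof (intro exI conjI ballI)
    show "(\<lambda>t. (R + norm v * (1 + R)) / c ^ 2 * (t powr Re s * exp (- (Re v * t)))) integrable_on {0<..}"
      by (intro integrable_on_mult_right gamma_kernel_integrable s v)
    fix w and t :: real assume w: "w \<in> ball z d" and t: "t \<in> {0<..}"
    have "norm w \<le> R" using w norm_triangle_sub[of w z] by (simp add: R_def dist_norm norm_minus_commute)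
    moreover have "exp (- t) \<in> {0..1}" using t by auto
    ultimately show "norm (lerch_integrand s v w t) \<le> (R + norm v * (1 + R)) / c ^ 2 * (t powr Re s * exp (- (Re v * t)))"
      using away w t d by (intro norm_lerch_integrand_le) auto
  qed (use d in auto)
qed

lemma lerch_integrand_integrable:
  assumes s: "Re s > -1" and v: "Re v > 0" and z: "z \<in> slit_plane"
  shows "lerch_integrand s v z integrable_on {0<..}"
proof -
  obtain d g where "d > 0" "g integrable_on {0<..}"
      "\<forall>w\<in>ball z d. \<forall>t\<in>{0<..}. norm (lerch_integrand s v w t) \<le> g t"
    using lerch_integrand_locally_dominated[OF assms] by blast
  then show ?thesis
    by (intro integrable_of_continuous_dominated[OF continuous_on_lerch_integrand[OF z], of g]) auto
qed

lemma lerch_integral_holomorphic: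
  assumes s: "Re s > -1" and v: "Re v > 0"
  shows "lerch_integral s v holomorphic_on slit_plane"
proof -
  have "(\<lambda>z. integral {0<..} (lerch_integrand s v z)) holomorphic_on slit_plane"
  proof (rule dominated_parametric_integral_holomorphic[OF open_slit])
    show "(\<lambda>z. lerch_integrand s v z t) holomorphic_on slit_plane" if "t \<in> {0<..}" for t
      unfolding lerch_integrand_def lerch_kernel_def
      using one_notin_kernel_arg that by (intro holomorphic_intros) auto
  qed (use lerch_integrand_integrable[OF assms] lerch_integrand_locally_dominated[OF assms] in auto)
  moreover have "Gamma (s + 1) \<noteq> 0"
    using s by (intro Gamma_nonzero) (auto elim!: nonpos_Ints_cases dest!: arg_cong[where f = Re])
  ultimately show ?thesis
    unfolding lerch_integral_def by (intro holomorphic_intros) auto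
qed

text \<open>
  Integrating the kernel series term by term produces \<open>(n + v) \<Gamma>(s+1) (n + v)\<^sup>-\<^sup>s\<^sup>-\<^sup>1\<close> as the
  coefficient of \<open>z\<^sup>n\<close>.
\<close>
lemma lerch_integral_sums:
  assumes s: "Re s > -1" and v: "Re v > 0" and z: "norm z < 1"
  shows "(\<lambda>n. z ^ n * (of_nat n + v) powr (- s)) sums lerch_integral s v z"
proof -
  have G: "Gamma (s + 1) \<noteq> 0"
    using s by (intro Gamma_nonzero) (auto elim!: nonpos_Ints_cases dest!: arg_cong[where f = Re])
  let ?h = "\<lambda>n t. (of_nat n + v) * z ^ n * (of_real t powr ((s + 1) - 1) * exp (- ((of_nat n + v) * complex_of_real t)))"
  define B where "B = (\<Sum>n. norm (of_nat n + v) * norm z ^ n)"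
  have summB: "summable (\<lambda>n. norm (of_nat n + v) * norm z ^ n)"
  proof (rule summable_comparison_test')
    have "(\<lambda>n. of_nat (Suc n) * norm z ^ n + norm v * norm z ^ n) sums
            (1 / (1 - norm z)\<^sup>2 + norm v * (1 / (1 - norm z)))"
      using z by (intro sums_add sums_mult geometric_deriv_sums geometric_sums) auto
    then show "summable (\<lambda>n. of_nat (Suc n) * norm z ^ n + norm v * norm z ^ n)"
      by (rule sums_summable)
    fix n
    have "norm (of_nat n + v) \<le> of_nat (Suc n) + norm v"
      using norm_triangle_ineq[of "of_nat n" v] by simp
    then have "norm (of_nat n + v) * norm z ^ n \<le> (of_nat (Suc n) + norm v) * norm z ^ n"
      by (intro mult_right_mono) auto
    then show "norm (norm (of_nat n + v) * norm z ^ n) \<le> of_nat (Suc n) * norm z ^ n + norm v * norm z ^ n"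
      by (simp add: algebra_simps)
  qed
  have hint: "(?h n has_integral (of_nat n + v) * z ^ n * (Gamma (s + 1) * (of_nat n + v) powr (- (s + 1)))) {0<..}" for n
    using s v by (intro has_integral_mult_right gamma_integral_scaled) auto
  have hpow: "?h n t = of_real t powr s * exp (- (v * of_real t)) * ((of_nat n + v) * (z * of_real (exp (- t))) ^ n)" for n t
    by (simp add: power_mult_distrib exp_of_nat_mult[symmetric] exp_of_real[symmetric] ring_distribs exp_diff exp_minus field_simps
        flip: of_real_power)
  have hle: "norm (?h n t) \<le> norm (of_nat n + v) * norm z ^ n * (t powr Re s * exp (- (Re v * t)))" if "t > 0" for n t
  proof -
    have "Re v * t \<le> Re (of_nat n + v) * t" using that by (intro mult_right_mono) auto
    then have le: "exp (- (Re (of_nat n + v) * t)) \<le> exp (- (Re v * t))" by simp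
    show ?thesis
      unfolding norm_mult[of "(of_nat n + v) * z ^ n"] norm_mult[of "of_nat n + v"] norm_power
        add_diff_cancel_right' norm_gamma_kernel[OF that]
      by (intro mult_left_mono le) auto
  qed
  have lim: "(\<lambda>N. \<Sum>n<N. ?h n t) \<longlonglongrightarrow> lerch_integrand s v z t" if "t > 0" for t
  proof -
    have "norm (z * of_real (exp (- t))) \<le> norm z * 1"
      unfolding norm_mult using that by (intro mult_left_mono) auto
    then have "norm (z * of_real (exp (- t))) < 1" using z by linarith
    from sums_mult[OF lerch_kernel_sums[OF this, of v], of "of_real t powr s * exp (- (v * of_real t))"]
    show ?thesis
      unfolding hpow lerch_integrand_def sums_def .
  qed
  have zs: "z \<in> slit_plane" using ball_subset_slit z by auto
  have "(\<lambda>N. integral {0<..} (\<lambda>t. \<Sum>n<N. ?h n t)) \<longlonglongrightarrow> integral {0<..} (lerch_integrand s v z)"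
  proof (rule dominated_convergence)
    show "(\<lambda>t. \<Sum>n<N. ?h n t) integrable_on {0<..}" for N
      by (intro integrable_sum has_integral_integrable[OF hint]) auto
    show "(\<lambda>t. B * (t powr Re s * exp (- (Re v * t)))) integrable_on {0<..}"
      by (intro integrable_on_mult_right gamma_kernel_integrable s v)
    fix N and t :: real assume t: "t \<in> {0<..}"
    have "norm (\<Sum>n<N. ?h n t) \<le> (\<Sum>n<N. norm (of_nat n + v) * norm z ^ n * (t powr Re s * exp (- (Re v * t))))"
      using t by (intro sum_norm_le hle) auto
    also have "\<dots> = (\<Sum>n<N. norm (of_nat n + v) * norm z ^ n) * (t powr Re s * exp (- (Re v * t)))"
      by (simp only: sum_distrib_right)
    also have "\<dots> \<le> B * (t powr Re s * exp (- (Re v * t)))"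
      unfolding B_def by (intro mult_right_mono sum_le_suminf summB) auto
    finally show "norm (\<Sum>n<N. ?h n t) \<le> B * (t powr Re s * exp (- (Re v * t)))" .
  qed (use lim in auto)
  moreover have "integral {0<..} (\<lambda>t. \<Sum>n<N. ?h n t) = Gamma (s + 1) * (\<Sum>n<N. z ^ n * (of_nat n + v) powr (- s))" for N
  proof -
    have "((\<lambda>t. \<Sum>n<N. ?h n t) has_integral (\<Sum>n<N. (of_nat n + v) * z ^ n * (Gamma (s + 1) * (of_nat n + v) powr (- (s + 1))))) {0<..}"
      by (intro has_integral_sum hint) auto
    moreover have "(of_nat n + v) * (of_nat n + v) powr (- (s + 1)) = (of_nat n + v) powr (- s)" for n
    proof -
      have "Re (of_nat n + v) > 0" using v by (simp add: add_nonneg_pos)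
      then have "of_nat n + v \<noteq> 0" by (metis less_irrefl zero_complex.simps(1))
      then show ?thesis using powr_add[of "of_nat n + v" 1 "- (s + 1)"] by simp
    qed
    then have "(of_nat n + v) * z ^ n * (Gamma (s + 1) * (of_nat n + v) powr (- (s + 1)))
        = Gamma (s + 1) * (z ^ n * (of_nat n + v) powr (- s))" for n
      by (metis (no_types, opaque_lifting) mult.assoc mult.commute)
    ultimately have "((\<lambda>t. \<Sum>n<N. ?h n t) has_integral (\<Sum>n<N. Gamma (s + 1) * (z ^ n * (of_nat n + v) powr (- s)))) {0<..}"
      by (simp only:)
    then show ?thesis by (simp only: integral_unique sum_distrib_left)
  qed
  ultimately have "(\<lambda>N. Gamma (s + 1) * (\<Sum>n<N. z ^ n * (of_nat n + v) powr (- s)) / Gamma (s + 1))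
      \<longlonglongrightarrow> integral {0<..} (lerch_integrand s v z) / Gamma (s + 1)"
    using G by (intro tendsto_divide tendsto_const) simp_all
  then show ?thesis using G by (simp add: sums_def lerch_integral_def)
qed

text \<open>
  One bound for the distance from \<open>1\<close> to a point on the radius to \<open>z\<close> is independent of \<open>r\<close>, the other
  of \<open>z\<close>; a geometric mean of the two separates the variables in \<open>lerch_integral_bound\<close>.
\<close>
lemma norm_one_minus_scaled_ge:
  fixes z :: complex
  assumes z: "norm z = 1" and r: "0 \<le> r" "r \<le> 1"
  shows "norm (1 - z) / 2 \<le> norm (1 - of_real r * z)" and "1 - r \<le> norm (1 - of_real r * z)"
proof -
  have "norm (1::complex) - norm (of_real r * z) \<le> norm (1 - of_real r * z)"
    by (rule norm_triangle_ineq2)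
  then show le: "1 - r \<le> norm (1 - of_real r * z)"
    using z r by (simp add: norm_mult)
  have "norm ((1 - of_real r * z) - of_real (1 - r) * z) \<le> norm (1 - of_real r * z) + norm (of_real (1 - r) * z)"
    by (rule norm_triangle_ineq4)
  also have "norm (of_real (1 - r) * z) = 1 - r"
    using z r unfolding norm_mult norm_of_real by simp
  also have "(1 - of_real r * z) - of_real (1 - r) * z = 1 - z"
    by (simp add: algebra_simps)
  finally show "norm (1 - z) / 2 \<le> norm (1 - of_real r * z)" using le by simp
qed

lemma one_minus_exp_neg_powr_le:
  fixes t \<theta> :: real
  assumes t: "t > 0" and \<theta>: "0 \<le> \<theta>" "\<theta> \<le> 2"
  shows "(1 - exp (- t)) powr (- \<theta>) \<le> (1 + t) ^ 2 * t powr (- \<theta>)"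
proof -
  have "1 + t \<le> exp t" by (rule exp_ge_add_one_self)
  then have "exp (- t) \<le> 1 / (1 + t)"
    using t by (simp add: exp_minus field_simps)
  then have "t / (1 + t) \<le> 1 - exp (- t)" using t by (simp add: field_simps)
  then have "(1 - exp (- t)) powr (- \<theta>) \<le> (t / (1 + t)) powr (- \<theta>)"
    using t \<theta> by (intro powr_mono2') auto
  also have "\<dots> = (1 + t) powr \<theta> * t powr (- \<theta>)"
    using t by (simp add: powr_divide powr_minus field_simps)
  also have "\<dots> \<le> (1 + t) powr 2 * t powr (- \<theta>)"
    using t \<theta> by (intro mult_right_mono powr_mono) auto
  finally show ?thesis using t by simp
qed

text \<open>
  The denominator of the kernel is quadratic in the distance \<open>\<bar>1 - u\<bar>\<close>, where \<open>u = r z e\<^sup>-\<^sup>t\<close>. Distributing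
  the exponent \<open>2 = p + \<theta>\<close> over the two lower bounds for that distance gives \<open>\<bar>1 - z\<bar>\<^sup>-\<^sup>p\<close> times
  \<open>(1 - e\<^sup>-\<^sup>t)\<^sup>-\<^sup>\<theta>\<close>, and the latter is integrable against \<open>t\<^sup>s\<close> at \<open>t = 0\<close> if \<open>\<theta> < Re s + 1\<close>, that is,
  if \<open>p > 1 - Re s\<close>.
\<close>
lemma lerch_integral_bound:
  assumes s: "Re s > -1" and v: "Re v > 0" and p: "0 < p" "p < 2" "1 - Re s < p"
  shows "\<exists>C\<ge>0. \<forall>z r. norm z = 1 \<longrightarrow> z \<noteq> 1 \<longrightarrow> 0 \<le> r \<longrightarrow> r \<le> 1 \<longrightarrow>
           norm (lerch_integral s v (of_real r * z)) \<le> C * norm (1 - z) powr (- p)"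
proof -
  define \<theta> where "\<theta> = 2 - p"
  have \<theta>: "0 < \<theta>" "\<theta> < 2" "Re s - \<theta> > -1" using p by (auto simp: \<theta>_def)
  define K where "K = 1 + norm v * (1 + 1)"
  have K: "K \<ge> 0" by (simp add: K_def)
  define g where "g = (\<lambda>t. (1 + t) ^ 2 * (t powr (Re s - \<theta>) * exp (- (Re v * t))))"
  have g: "g integrable_on {0<..}"
  proof -
    have "(\<lambda>t. t powr (Re s - \<theta>) * exp (- (Re v * t)) + 2 * (t powr (Re s - \<theta> + 1) * exp (- (Re v * t)))
            + t powr (Re s - \<theta> + 2) * exp (- (Re v * t))) integrable_on {0<..}"
      using \<theta> v by (intro integrable_add integrable_on_mult_right gamma_kernel_integrable) auto
    then show ?thesis
    proof (rule integrable_eq)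
      fix t :: real assume "t \<in> {0<..}"
      then have "t powr (Re s - \<theta> + 1) = t powr (Re s - \<theta>) * t"
        "t powr (Re s - \<theta> + 2) = t powr (Re s - \<theta>) * t ^ 2"
        by (auto simp: powr_add)
      then show "t powr (Re s - \<theta>) * exp (- (Re v * t)) + 2 * (t powr (Re s - \<theta> + 1) * exp (- (Re v * t)))
            + t powr (Re s - \<theta> + 2) * exp (- (Re v * t)) = g t"
        by (simp only: g_def) (simp add: algebra_simps power2_eq_square)
    qed
  qed
  define C where "C = K * 2 powr p * integral {0<..} g / norm (Gamma (s + 1))"
  have "integral {0<..} g \<ge> 0"
    by (intro integral_nonneg g) (auto simp: g_def)
  then have "C \<ge> 0" using K by (auto simp: C_def)
  moreover have "norm (lerch_integral s v (of_real r * z)) \<le> C * norm (1 - z) powr (- p)"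
    if z: "norm z = 1" "z \<noteq> 1" and r: "0 \<le> r" "r \<le> 1" for z r
  proof -
    have rz: "of_real r * z \<in> slit_plane" using unit_circle_in_slit[OF z] r by (intro slit_scale) auto
    define A where "A = norm (1 - z) / 2"
    have A: "A > 0" using z by (simp add: A_def)
    have le: "norm (lerch_integrand s v (of_real r * z) t) \<le> K * A powr (- p) * g t" if t: "t > 0" for t
    proof -
      define B where "B = 1 - exp (- t)"
      have B: "B > 0" using t by (simp add: B_def)
      define N where "N = norm (1 - of_real r * z * of_real (exp (- t)))"
      have re: "r * exp (- t) \<le> 1 * exp (-t)" "0 \<le> r * exp (- t)"
        using r by (auto intro: mult_right_mono)
      have N_eq: "N = norm (1 - of_real (r * exp (- t)) * z)"
        by (simp add: N_def mult_ac)
      have re1: "r * exp (- t) \<le> 1" using re t by (intro order_trans[OF re(1)]) auto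
      have NA: "A \<le> N"
        unfolding A_def N_eq by (rule norm_one_minus_scaled_ge[OF z(1) re(2) re1])
      have "1 - r * exp (- t) \<le> N"
        unfolding N_eq by (rule norm_one_minus_scaled_ge[OF z(1) re(2) re1])
      then have NB: "B \<le> N" unfolding B_def using re(1) by linarith
      \<comment> \<open>a weighted geometric mean of the lower bounds \<open>A\<close> and \<open>B\<close> of \<open>N\<close>, as \<open>p / 2 + \<theta> / 2 = 1\<close>\<close>
      define c where "c = A powr (p / 2) * B powr (\<theta> / 2)"
      have c: "c > 0" using A B by (simp add: c_def)
      have "c \<le> N powr (p / 2) * N powr (\<theta> / 2)"
        unfolding c_def using A B NA NB p \<theta> by (intro mult_mono powr_mono2) auto
      also have "\<dots> = N powr (p / 2 + \<theta> / 2)" by (rule powr_add[symmetric])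
      also have "p / 2 + \<theta> / 2 = 1" by (simp add: \<theta>_def field_simps)
      finally have cN: "c \<le> N" using A NA by simp
      have c2: "c ^ 2 = A powr p * B powr \<theta>"
        using A B by (simp add: c_def power2_eq_square powr_add[symmetric] mult_ac)
      have "norm (of_real r * z) \<le> 1" using z r by (simp add: norm_mult)
      then have "norm (lerch_integrand s v (of_real r * z) t) \<le> K / c ^ 2 * (t powr Re s * exp (- (Re v * t)))"
        unfolding K_def using cN c t by (intro norm_lerch_integrand_le) (auto simp: N_def)
      also have "K / c ^ 2 = K * A powr (- p) * B powr (- \<theta>)"
        unfolding c2 using A B by (simp add: powr_minus field_simps)
      also have "K * A powr (- p) * B powr (- \<theta>) * (t powr Re s * exp (- (Re v * t)))
          \<le> K * A powr (- p) * ((1 + t) ^ 2 * t powr (- \<theta>)) * (t powr Re s * exp (- (Re v * t)))"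
        unfolding B_def using K t \<theta>
        by (intro mult_right_mono mult_left_mono one_minus_exp_neg_powr_le) auto
      also have "\<dots> = K * A powr (- p) * g t"
        by (simp add: g_def powr_diff powr_minus field_simps)
      finally show ?thesis .
    qed
    have "norm (integral {0<..} (lerch_integrand s v (of_real r * z))) \<le> integral {0<..} (\<lambda>t. K * A powr (- p) * g t)"
      by (intro integral_norm_bound_integral lerch_integrand_integrable s v rz integrable_on_mult_right g le) auto
    also have "\<dots> = K * A powr (- p) * integral {0<..} g" by simp
    also have "A powr (- p) = 2 powr p * norm (1 - z) powr (- p)"
      by (simp add: A_def powr_divide powr_minus field_simps)
    finally have "norm (integral {0<..} (lerch_integrand s v (of_real r * z))) / norm (Gamma (s + 1))
       \<le> K * (2 powr p * norm (1 - z) powr (- p)) * integral {0<..} g / norm (Gamma (s + 1))"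
      by (intro divide_right_mono) auto
    then show ?thesis by (simp add: lerch_integral_def norm_divide C_def mult_ac)
  qed
  ultimately show ?thesis by blast
qed

definition lerch_coeff :: "complex \<Rightarrow> complex \<Rightarrow> nat \<Rightarrow> complex" where
  "lerch_coeff s v n = 1 / (if s = 0 then 1 else (of_nat n + v) powr s)"

lemma lerch_series_eq: "lerch_series z s v = (\<Sum>n. lerch_coeff s v n * z ^ n)"
  by (simp add: lerch_series_def lerch_coeff_def)

text \<open>
  For \<open>N\<close> large enough \<open>v + N\<close> has positive real part, and the series equals a polynomial plus
  \<open>z\<^sup>N\<close> times the series with parameter \<open>v + N\<close>, which the integral continues.
\<close>
lemma lerch_series_continuation:
  assumes s: "Re s > -1"
  obtains f where "f holomorphic_on slit_plane" "\<And>z. norm z < 1 \<Longrightarrow> f z = lerch_series z s v"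
    "\<And>p. 0 < p \<Longrightarrow> p < 2 \<Longrightarrow> 1 - Re s < p \<Longrightarrow> \<exists>C\<ge>0. \<forall>z r. norm z = 1 \<longrightarrow> z \<noteq> 1 \<longrightarrow> 0 \<le> r \<longrightarrow> r \<le> 1 \<longrightarrow>
           norm (f (of_real r * z)) \<le> C * norm (1 - z) powr (- p)"
proof -
  obtain N where "- Re v < of_nat N" using reals_Archimedean2 by blast
  define w where "w = v + of_nat N"
  have w: "Re w > 0" using \<open>- Re v < of_nat N\<close> by (simp add: w_def)
  define P where "P = (\<lambda>z. \<Sum>n<N. lerch_coeff s v n * z ^ n)"
  define f where "f = (\<lambda>z. z ^ N * lerch_integral s w z + P z)"
  show ?thesis
  proof
    show "f holomorphic_on slit_plane"
      unfolding f_def P_def by (intro holomorphic_intros lerch_integral_holomorphic s w)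
    show "f z = lerch_series z s v" if z: "norm z < 1" for z
    proof -
      have "(\<lambda>n. z ^ N * (z ^ n * (of_nat n + w) powr (- s))) sums (z ^ N * lerch_integral s w z)"
        by (intro sums_mult lerch_integral_sums s w z)
      moreover have "z ^ N * (z ^ n * (of_nat n + w) powr (- s)) = lerch_coeff s v (n + N) * z ^ (n + N)" for n
      proof -
        have "Re (of_nat n + w) > 0" using w by (simp add: add_nonneg_pos)
        then have "of_nat n + w \<noteq> 0" by (metis less_irrefl zero_complex.simps(1))
        then have "(of_nat n + w) powr (- s) = lerch_coeff s v (n + N)"
          by (auto simp: lerch_coeff_def w_def powr_minus divide_inverse add_ac)
        then show ?thesis by (simp add: power_add mult_ac)
      qed
      ultimately have "(\<lambda>n. lerch_coeff s v n * z ^ n) sums (z ^ N * lerch_integral s w z + P z)"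
        unfolding P_def by (simp only: sums_iff_shift[where f = "\<lambda>n. lerch_coeff s v n * z ^ n"])
      then show ?thesis by (simp add: lerch_series_eq f_def sums_iff)
    qed
    fix p assume p: "0 < p" "p < 2" "1 - Re s < p"
    obtain C where C: "C \<ge> 0" "\<And>z r. norm z = 1 \<Longrightarrow> z \<noteq> 1 \<Longrightarrow> 0 \<le> r \<Longrightarrow> r \<le> 1 \<Longrightarrow>
           norm (lerch_integral s w (of_real r * z)) \<le> C * norm (1 - z) powr (- p)"
      using lerch_integral_bound[OF s w p] by blast
    define D where "D = (\<Sum>n<N. norm (lerch_coeff s v n))"
    have D: "D \<ge> 0" by (auto simp: D_def intro: sum_nonneg)
    show "\<exists>C\<ge>0. \<forall>z r. norm z = 1 \<longrightarrow> z \<noteq> 1 \<longrightarrow> 0 \<le> r \<longrightarrow> r \<le> 1 \<longrightarrow>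
           norm (f (of_real r * z)) \<le> C * norm (1 - z) powr (- p)"
    proof (intro exI[of _ "C + D * 2 powr p"] conjI allI impI)
      show "0 \<le> C + D * 2 powr p" using C(1) D by simp
      fix z :: complex and r :: real
      assume z: "norm z = 1" "z \<noteq> 1" and r: "0 \<le> r" "r \<le> 1"
      have nrz: "norm (of_real r * z) \<le> 1" using z r by (simp add: norm_mult)
      have "norm ((of_real r * z) ^ N * lerch_integral s w (of_real r * z))
          \<le> 1 * (C * norm (1 - z) powr (- p))"
        unfolding norm_mult[of "_ ^ N"] norm_power using C z r nrz
        by (intro mult_mono power_le_one) auto
      moreover have "norm (P (of_real r * z)) \<le> D * 2 powr p * norm (1 - z) powr (- p)"
      proof -
        have "norm (P (of_real r * z)) \<le> D"
          unfolding P_def D_def using nrz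
          by (intro sum_norm_le) (simp add: norm_mult[of "lerch_coeff _ _ _"] norm_power power_le_one mult_left_le)
        also have "D = D * (2 powr p * 2 powr (- p))" by (simp add: powr_minus)
        also have "\<dots> \<le> D * (2 powr p * norm (1 - z) powr (- p))"
        proof (intro mult_left_mono powr_mono2')
          show "norm (1 - z) \<le> 2" using norm_triangle_ineq4[of 1 z] z by simp
        qed (use D p z in auto)
        finally show ?thesis by simp
      qed
      ultimately show "norm (f (of_real r * z)) \<le> (C + D * 2 powr p) * norm (1 - z) powr (- p)"
        unfolding f_def distrib_right by (intro norm_triangle_le) auto
    qed
  qed
qed

text \<open>
  The identity theorem makes the description in the definition of the Lerch function unique. For
  \<open>Re s > 1\<close> the definition takes the series, not the continuation, as the value on the unit circle.
\<close>
lemma hurwitz_lerch_eq_continuation: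
  assumes f: "f holomorphic_on slit_plane" "\<And>u. norm u < 1 \<Longrightarrow> f u = lerch_series u s v"
    and z: "z \<in> slit_plane" and s: "Re s \<le> 1"
  shows "hurwitz_lerch z s v = f z"
proof (cases "norm z < 1")
  case True
  then show ?thesis using f by (simp add: hurwitz_lerch_def)
next
  case False
  have uniq: "g z = f z" if g: "g holomorphic_on slit_plane" "\<forall>u. norm u < 1 \<longrightarrow> g u = lerch_series u s v" for g
  proof -
    have "g z - f z = 0"
    proof (rule analytic_continuation[where f = "\<lambda>z. g z - f z" and U = "ball 0 1" and \<xi> = 0])
      show "(0::complex) islimpt ball 0 1" by (simp add: islimpt_ball)
    qed (use f g z open_slit connected_slit ball_subset_slit in \<open>auto intro: holomorphic_intros\<close>)
    then show ?thesis by simp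
  qed
  have "(THE w. \<exists>g. g holomorphic_on slit_plane \<and> (\<forall>u. norm u < 1 \<longrightarrow> g u = lerch_series u s v) \<and> g z = w) = f z"
    using f uniq by (intro the_equality) blast+
  then show ?thesis using False s by (simp add: hurwitz_lerch_def slit_plane_def)
qed

section \<open>Growth of the coefficients\<close>

text \<open>
  The principal power contributes \<open>\<bar>n + v\<bar> powr (- Re s)\<close> times a factor depending on the argument of
  \<open>n + v\<close>, which is bounded by \<open>\<pi>\<close>; and \<open>\<bar>n + v\<bar>\<close> lies between \<open>n / 2\<close> and \<open>2 n\<close> for large \<open>n\<close>.
\<close>
lemma lerch_coeff_eventually_le:
  "\<exists>K. \<forall>\<^sub>F n in sequentially. norm (lerch_coeff s v n) \<le> K * real n powr (- Re s)"
proof -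
  define K where "K = 2 powr \<bar>Re s\<bar> * exp (pi * \<bar>Im s\<bar>)"
  have K1: "1 \<le> K"
    unfolding K_def using mult_mono[of 1 "2 powr \<bar>Re s\<bar>" 1 "exp (pi * \<bar>Im s\<bar>)"]
    by (simp add: ge_one_powr_ge_zero)
  have "norm (lerch_coeff s v n) \<le> K * real n powr (- Re s)" if n: "real n \<ge> 2 * norm v + 1" for n
  proof (cases "s = 0")
    case True
    have "n \<noteq> 0" using n norm_ge_zero[of v] by (intro notI) simp
    then show ?thesis using True K1 by (auto simp: lerch_coeff_def)
  next
    case False
    have n0: "real n > 0" using n norm_ge_zero[of v] by linarith
    define y where "y = norm (of_nat n + v)"
    have y: "real n / 2 \<le> y" "y \<le> 2 * real n"
      using norm_triangle_ineq[of "of_nat n" v] norm_diff_ineq[of "of_nat n" v] n norm_ge_zero[of v]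
      unfolding y_def by (simp_all del: norm_ge_zero)
    have y0: "y > 0" using y n0 by linarith
    have "norm (lerch_coeff s v n) = y powr (- Re s) * exp (Im s * Arg (of_nat n + v))"
      using False by (simp add: lerch_coeff_def norm_divide norm_powr_complex y_def powr_minus exp_minus field_simps)
    moreover have "y powr (- Re s) \<le> 2 powr \<bar>Re s\<bar> * real n powr (- Re s)"
    proof (cases "Re s \<ge> 0")
      case True
      have "y powr (- Re s) \<le> (real n / 2) powr (- Re s)"
        using True y n0 by (intro powr_mono2') auto
      then show ?thesis using True n0 by (simp add: powr_divide powr_minus field_simps)
    next
      case False
      have "y powr (- Re s) \<le> (2 * real n) powr (- Re s)"
        using False y y0 by (intro powr_mono2) auto
      then show ?thesis using False n0 by (simp add: powr_mult)
    qed
    moreover have "exp (Im s * Arg (of_nat n + v)) \<le> exp (pi * \<bar>Im s\<bar>)"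
    proof -
      have "Im s * Arg (of_nat n + v) \<le> \<bar>Im s\<bar> * \<bar>Arg (of_nat n + v)\<bar>"
        by (metis abs_ge_self abs_mult)
      also have "\<dots> \<le> \<bar>Im s\<bar> * pi"
        using Arg_bounded[of "of_nat n + v"] by (intro mult_left_mono) auto
      finally show ?thesis by (simp add: mult.commute)
    qed
    ultimately have "norm (lerch_coeff s v n) \<le> (2 powr \<bar>Re s\<bar> * real n powr (- Re s)) * exp (pi * \<bar>Im s\<bar>)"
      by (simp only:) (intro mult_mono, auto)
    then show ?thesis by (simp add: K_def mult_ac)
  qed
  moreover have "real n \<ge> 2 * norm v + 1" if "n \<ge> nat \<lceil>2 * norm v + 1\<rceil>" for n
    using that by linarith
  ultimately have "\<forall>\<^sub>F n in sequentially. norm (lerch_coeff s v n) \<le> K * real n powr (- Re s)"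
    by (intro eventually_sequentiallyI[of "nat \<lceil>2 * norm v + 1\<rceil>"]) blast
  then show ?thesis by blast
qed

lemma lerch_coeff_summable_inside:
  assumes r: "0 < r" "r < 1"
  shows "summable (\<lambda>n. norm (lerch_coeff s v n) * r ^ n * real (Suc n) powr 1)"
proof -
  obtain K where K: "\<forall>\<^sub>F n in sequentially. norm (lerch_coeff s v n) \<le> K * real n powr (- Re s)"
    using lerch_coeff_eventually_le by blast
  have "(\<lambda>n::nat. real n powr (- Re s) * real (Suc n) * r ^ n) \<in> O(\<lambda>n. real n powr -2)"
    using r by real_asymp
  moreover have "summable (\<lambda>n. norm (real n powr -2))" by (simp add: summable_real_powr_iff)
  ultimately have "summable (\<lambda>n. real n powr (- Re s) * real (Suc n) * r ^ n)"
    by (rule summable_comparison_test_bigo[rotated])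
  then have "summable (\<lambda>n. K * (real n powr (- Re s) * real (Suc n) * r ^ n))"
    by (rule summable_mult)
  then show ?thesis
  proof (rule summable_comparison_test_ev[rotated])
    show "\<forall>\<^sub>F n in sequentially. norm (norm (lerch_coeff s v n) * r ^ n * real (Suc n) powr 1)
             \<le> K * (real n powr (- Re s) * real (Suc n) * r ^ n)"
      using K
    proof eventually_elim
      case (elim n)
      then have "norm (lerch_coeff s v n) * (r ^ n * real (Suc n)) \<le> K * real n powr (- Re s) * (r ^ n * real (Suc n))"
        using r by (intro mult_right_mono) auto
      then show ?case using r by (simp add: mult_ac)
    qed
  qed
qed

lemma lerch_coeff_summable_boundary:
  assumes e: "e > 0" "e < Re s - 1"
  shows "summable (\<lambda>n. norm (lerch_coeff s v n) * real (Suc n) powr e)"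
proof -
  obtain K where K: "\<forall>\<^sub>F n in sequentially. norm (lerch_coeff s v n) \<le> K * real n powr (- Re s)"
    using lerch_coeff_eventually_le by blast
  have "(\<lambda>n::nat. real n powr (- Re s) * real (Suc n) powr e) \<in> O(\<lambda>n. real n powr (e - Re s))"
    by real_asymp
  moreover have "summable (\<lambda>n. norm (real n powr (e - Re s)))"
    using e by (simp add: summable_real_powr_iff)
  ultimately have "summable (\<lambda>n. real n powr (- Re s) * real (Suc n) powr e)"
    by (rule summable_comparison_test_bigo[rotated])
  then have "summable (\<lambda>n. K * (real n powr (- Re s) * real (Suc n) powr e))"
    by (rule summable_mult)
  then show ?thesis
  proof (rule summable_comparison_test_ev[rotated])
    show "\<forall>\<^sub>F n in sequentially. norm (norm (lerch_coeff s v n) * real (Suc n) powr e)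
             \<le> K * (real n powr (- Re s) * real (Suc n) powr e)"
      using K
    proof eventually_elim
      case (elim n)
      then have "norm (lerch_coeff s v n) * real (Suc n) powr e \<le> K * real n powr (- Re s) * real (Suc n) powr e"
        by (intro mult_right_mono) auto
      then show ?case by (simp add: mult_ac)
    qed
  qed
qed

section \<open>Passage to the unit circle\<close>

text \<open>
  The sign \<open>e\<close> treats the arguments \<open>q exp (2 \<i> x)\<close> and \<open>q exp (- 2 \<i> x)\<close> at the same time.
\<close>
lemma norm_one_minus_rotation:
  assumes "e = 1 \<or> e = - (1::real)"
  shows "norm (1 - exp (\<i> * of_real \<alpha>) * exp (of_real e * (2 * \<i> * of_real x)))
           = 2 * \<bar>sin (x + e * \<alpha> / 2)\<bar>"
proof -
  have "exp (\<i> * of_real \<alpha>) * exp (of_real e * (2 * \<i> * of_real x)) = exp (\<i> * of_real (\<alpha> + e * 2 * x))"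
    by (simp add: exp_add[symmetric] algebra_simps)
  then have "norm (1 - exp (\<i> * of_real \<alpha>) * exp (of_real e * (2 * \<i> * of_real x)))
      = 2 * \<bar>sin ((\<alpha> + e * 2 * x) / 2)\<bar>"
    by (simp only: dist_exp_i_1 norm_minus_commute[of 1])
  also have "\<bar>sin ((\<alpha> + e * 2 * x) / 2)\<bar> = \<bar>sin (x + e * \<alpha> / 2)\<bar>"
  proof -
    have "(\<alpha> + e * 2 * x) / 2 = e * (x + e * \<alpha> / 2)" using assms by (auto simp: field_simps)
    then show ?thesis using assms by (auto simp only: mult_1 mult_minus_left sin_minus abs_minus_cancel)
  qed
  finally show ?thesis .
qed

lemma finite_zeros_rotation:
  assumes q: "norm q = 1" and e: "e = 1 \<or> e = - (1::real)"
  shows "finite {x \<in> {0..pi}. q * exp (of_real e * (2 * \<i> * of_real x)) = 1}"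
proof -
  obtain \<alpha> where \<alpha>: "q = exp (\<i> * of_real \<alpha>)" using q complex_norm_eq_1_exp by metis
  define b where "b = e * \<alpha> / 2"
  have "{x \<in> {0..pi}. q * exp (of_real e * (2 * \<i> * of_real x)) = 1}
      \<subseteq> (\<lambda>n. of_int n * pi - b) ` {\<lfloor>b / pi\<rfloor>..\<lceil>b / pi\<rceil> + 1}"
  proof
    fix x assume "x \<in> {x \<in> {0..pi}. q * exp (of_real e * (2 * \<i> * of_real x)) = 1}"
    then have x: "0 \<le> x" "x \<le> pi" and "norm (1 - q * exp (of_real e * (2 * \<i> * of_real x))) = 0" by auto
    then have "sin (x + b) = 0"
      unfolding \<alpha> norm_one_minus_rotation[OF e] b_def by simp
    then obtain n where n: "x + b = of_int n * pi" by (auto simp: sin_zero_iff_int2)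
    have "of_int n * pi \<ge> b" "of_int n * pi \<le> b + pi" using n x by linarith+
    then have "of_int n \<ge> b / pi" "of_int n \<le> b / pi + 1" by (auto simp: field_simps)
    then have "n \<in> {\<lfloor>b / pi\<rfloor>..\<lceil>b / pi\<rceil> + 1}" by simp linarith
    moreover have "x = of_int n * pi - b" using n by simp
    ultimately show "x \<in> (\<lambda>n. of_int n * pi - b) ` {\<lfloor>b / pi\<rfloor>..\<lceil>b / pi\<rceil> + 1}" by blast
  qed
  then show ?thesis by (rule finite_subset) auto
qed

text \<open>
  The chord is \<open>2 \<bar>sin (x \<plusminus> \<alpha>/2)\<bar>\<close> with \<open>\<alpha> = arg q\<close>, which has simple zeros. For \<open>q = - 1\<close> these are the
  zeros of \<open>cos\<close>, so that the factor \<open>\<bar>cos x\<bar>\<close> improves the exponent by one.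
\<close>
lemma cos_chord_powr_integrable:
  assumes q: "norm q = 1" and e: "e = 1 \<or> e = - (1::real)"
    and p: "0 \<le> p" "p < 1 \<or> (q = - 1 \<and> p < 2)"
  shows "(\<lambda>x. \<bar>cos x\<bar> * norm (1 - q * exp (of_real e * (2 * \<i> * of_real x))) powr (- p)) integrable_on {0..pi}"
    (is "?f integrable_on _")
proof -
  have meas: "?f \<in> borel_measurable (lebesgue_on {0..pi})"
    by (intro measurable_restrict_space1 measurable_completion) measurable
  show ?thesis
  proof (cases "p < 1")
    case True
    obtain \<alpha> where \<alpha>: "q = exp (\<i> * of_real \<alpha>)" using q complex_norm_eq_1_exp by metis
    show ?thesis
    proof (rule measurable_bounded_by_integrable_imp_integrable_real[OF meas])
      show "(\<lambda>x. 2 powr (- p) * \<bar>sin (x + e * \<alpha> / 2)\<bar> powr (- p)) integrable_on {0..pi}"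
        using True p by (intro integrable_on_mult_right abs_sin_powr_integrable) auto
      fix x :: real
      have "?f x = \<bar>cos x\<bar> * (2 powr (- p) * \<bar>sin (x + e * \<alpha> / 2)\<bar> powr (- p))"
        unfolding \<alpha> norm_one_minus_rotation[OF e] by (simp add: powr_mult)
      also have "\<dots> \<le> 1 * (2 powr (- p) * \<bar>sin (x + e * \<alpha> / 2)\<bar> powr (- p))"
        by (intro mult_right_mono) auto
      finally show "\<bar>?f x\<bar> \<le> 2 powr (- p) * \<bar>sin (x + e * \<alpha> / 2)\<bar> powr (- p)" by simp
    qed auto
  next
    case False
    then have p2: "1 \<le> p" "p < 2" and q1: "q = exp (\<i> * of_real pi)" using p by auto
    show ?thesis
    proof (rule measurable_bounded_by_integrable_imp_integrable_real[OF meas])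
      show "(\<lambda>x. 2 powr (- p) * \<bar>sin (x + pi / 2)\<bar> powr (- (p - 1))) integrable_on {0..pi}"
        using p2 by (intro integrable_on_mult_right abs_sin_powr_integrable) auto
      fix x :: real
      have "\<bar>sin (x + e * pi / 2)\<bar> = \<bar>cos x\<bar>" "sin (x + pi / 2) = cos x"
        using e by (auto simp: sin_add)
      moreover have "\<bar>cos x\<bar> * \<bar>cos x\<bar> powr (- p) = \<bar>cos x\<bar> powr (- (p - 1))"
        by (cases "cos x = 0") (auto simp: powr_diff powr_minus field_simps)
      ultimately show "\<bar>?f x\<bar> \<le> 2 powr (- p) * \<bar>sin (x + pi / 2)\<bar> powr (- (p - 1))"
        unfolding q1 norm_one_minus_rotation[OF e] by (simp add: powr_mult mult.left_commute)
    qed auto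
  qed
qed

lemma slit_closed_disc: "norm z \<le> 1 \<Longrightarrow> z \<noteq> 1 \<Longrightarrow> z \<in> slit_plane"
  using unit_circle_in_slit[of z] ball_subset_slit by (cases "norm z = 1") auto

text \<open>
  Applied with \<open>w\<close> and \<open>w'\<close> equal to \<open>exp (\<minusplus> 2 \<i> x)\<close>, this cancels the poles of \<open>cot\<close> uniformly in \<open>r\<close>.
  As long as \<open>w\<close> is closer to \<open>1\<close> than \<open>q\<close> is, the points \<open>r q w\<close> range over a compact subset of
  the slit plane, on which \<open>f\<close> and its derivative are bounded; and the set of
  such \<open>w\<close> in the closed disc is convex, so the mean value inequality applies.
\<close>
lemma uniformly_lipschitz_near_one:
  assumes f: "f holomorphic_on slit_plane" and q: "norm q = 1" "q \<noteq> 1"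
  obtains \<eta> M where "\<eta> > 0" "M \<ge> 0"
    "\<And>r w w'. 0 \<le> r \<Longrightarrow> r \<le> 1 \<Longrightarrow> norm w \<le> 1 \<Longrightarrow> norm w' \<le> 1 \<Longrightarrow> norm (w - 1) \<le> \<eta> \<Longrightarrow> norm (w' - 1) \<le> \<eta> \<Longrightarrow>
       norm (w * f (of_real r * q * w) - w' * f (of_real r * q * w')) \<le> M * norm (w - w')"
proof -
  define \<eta> where "\<eta> = norm (1 - q) / 2"
  have \<eta>: "\<eta> > 0" "\<eta> < norm (1 - q)" using q by (auto simp: \<eta>_def)
  define S where "S = cball 0 1 \<inter> cball (1::complex) \<eta>"
  have "compact S" "convex S" by (auto simp: S_def intro: compact_Int convex_Int)
  have qS: "q * w \<in> slit_plane" if "w \<in> S" for w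
  proof (rule slit_closed_disc)
    show "norm (q * w) \<le> 1" using that q by (simp add: S_def norm_mult)
    have "norm (q * w - q) = norm (1 - w)"
      using q by (metis mult.right_neutral norm_minus_commute norm_mult mult_1 right_diff_distrib)
    then have "norm (q * w - q) \<le> \<eta>" using that by (simp add: S_def dist_norm)
    then show "q * w \<noteq> 1" using \<eta> by auto
  qed
  define K where "K = (\<lambda>(r, w). of_real r * (q * w)) ` ({0..1::real} \<times> S)"
  have K: "compact K" unfolding K_def
    by (intro compact_continuous_image compact_Times \<open>compact S\<close>)
       (auto intro!: continuous_intros simp: case_prod_unfold)
  have Ks: "K \<subseteq> slit_plane" unfolding K_def using qS by (auto intro!: slit_scale)
  have f': "deriv f holomorphic_on slit_plane" by (intro holomorphic_deriv f open_slit)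
  have "bounded (f ` K)" "bounded (deriv f ` K)"
    by (intro compact_imp_bounded compact_continuous_image K
         continuous_on_subset[OF holomorphic_on_imp_continuous_on[OF f] Ks]
         continuous_on_subset[OF holomorphic_on_imp_continuous_on[OF f'] Ks])+
  then obtain M1 M2 where M: "\<And>z. z \<in> K \<Longrightarrow> norm (f z) \<le> M1" "\<And>z. z \<in> K \<Longrightarrow> norm (deriv f z) \<le> M2"
    unfolding bounded_iff by (auto simp: ball_simps)
  have "1 \<in> S" using \<eta> by (simp add: S_def)
  then have "of_real 1 * (q * 1) \<in> K" unfolding K_def by force
  then have M0: "0 \<le> M1" "0 \<le> M2" using M norm_ge_zero order_trans by blast+
  show ?thesis
  proof
    show "\<eta> > 0" by fact
    show "M1 + M2 \<ge> 0" using M0 by simp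
    fix r :: real and w w' :: complex
    assume r: "0 \<le> r" "r \<le> 1" and w: "norm w \<le> 1" "norm w' \<le> 1" "norm (w - 1) \<le> \<eta>" "norm (w' - 1) \<le> \<eta>"
    have wS: "w \<in> S" "w' \<in> S" using w by (auto simp: S_def dist_norm norm_minus_commute)
    show "norm (w * f (of_real r * q * w) - w' * f (of_real r * q * w')) \<le> (M1 + M2) * norm (w - w')"
    proof (rule field_differentiable_bound[OF \<open>convex S\<close> _ _ wS])
      fix z assume z: "z \<in> S"
      then have zK: "of_real r * q * z \<in> K" unfolding K_def using r by (force simp: mult.assoc)
      then have "(f has_field_derivative deriv f (of_real r * q * z)) (at (of_real r * q * z))"
        using holomorphic_derivI[OF f open_slit] Ks by blast
      then show "((\<lambda>w. w * f (of_real r * q * w)) has_field_derivative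
            (f (of_real r * q * z) + z * (deriv f (of_real r * q * z) * (of_real r * q)))) (at z within S)"
        by (auto intro!: derivative_eq_intros DERIV_chain2[of f])
      have "norm z * (norm (deriv f (of_real r * q * z)) * (r * 1)) \<le> 1 * (M2 * (1 * 1))"
        using M0 M(2)[OF zK] z r by (intro mult_mono) (auto simp: S_def)
      then show "norm (f (of_real r * q * z) + z * (deriv f (of_real r * q * z) * (of_real r * q))) \<le> M1 + M2"
        using M(1)[OF zK] q r by (intro norm_triangle_le add_mono) (auto simp: norm_mult)
    qed
  qed
qed

text \<open>
  Dominated convergence along the radius towards \<open>q\<close>. The majorant \<open>g\<close> adds up a constant for the
  neighbourhoods of the poles of \<open>cot\<close> and the bound for \<open>f\<close> away from them.
\<close>
lemma has_integral_cot_boundary: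
  assumes f: "f holomorphic_on slit_plane" and q: "norm q = 1" "q \<noteq> 1"
    and C: "C \<ge> 0" "\<And>z r. norm z = 1 \<Longrightarrow> z \<noteq> 1 \<Longrightarrow> 0 \<le> r \<Longrightarrow> r \<le> 1 \<Longrightarrow>
              norm (f (of_real r * z)) \<le> C * norm (1 - z) powr (- p)"
    and p: "0 \<le> p" "p < 1 \<or> (q = - 1 \<and> p < 2)"
  shows "((\<lambda>x::real. exp (- 2 * \<i> * of_real x) * of_real (cot x) *
            (f (q * exp (- 2 * \<i> * of_real x))
             - exp (4 * \<i> * of_real x) * f (q * exp (2 * \<i> * of_real x))))
          has_integral (- 2 * \<i> * of_real pi * f q)) {0..pi}"
proof -
  obtain \<eta> M where \<eta>: "\<eta> > 0" "M \<ge> 0" and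
    lip: "\<And>r w w'. 0 \<le> r \<Longrightarrow> r \<le> 1 \<Longrightarrow> norm w \<le> 1 \<Longrightarrow> norm w' \<le> 1 \<Longrightarrow> norm (w - 1) \<le> \<eta> \<Longrightarrow> norm (w' - 1) \<le> \<eta> \<Longrightarrow>
       norm (w * f (of_real r * q * w) - w' * f (of_real r * q * w')) \<le> M * norm (w - w')"
    using uniformly_lipschitz_near_one[OF f q] by metis
  define u where "u = (\<lambda>x. exp (2 * \<i> * complex_of_real x))"
  have nu: "norm (u x) = 1" "norm (inverse (u x)) = 1" "u x \<noteq> 0" for x
    by (simp_all add: u_def norm_inverse)
  have u: "exp (- 2 * \<i> * of_real x) = inverse (u x)" "exp (4 * \<i> * of_real x) = u x ^ 2" for x :: real
    by (auto simp: u_def exp_minus[symmetric] exp_of_nat_mult[symmetric] mult.assoc)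
  have ue: "exp (of_real 1 * (2 * \<i> * of_real x)) = u x" "exp (of_real (-1) * (2 * \<i> * of_real x)) = inverse (u x)" for x :: real
    by (auto simp: u_def exp_minus)
  \<comment> \<open>the points where an argument reaches the cut: there \<open>f\<close> is not controlled\<close>
  define X where "X = {x \<in> {0..pi}. q * u x = 1} \<union> {x \<in> {0..pi}. q * inverse (u x) = 1}"
  have "finite X"
    unfolding X_def using finite_zeros_rotation[OF q(1), of 1] finite_zeros_rotation[OF q(1), of "-1"]
    by (simp only: ue finite_Un simp_thms)
  define F where "F = (\<lambda>r x. of_real (cot x) *
      (inverse (u x) * f (of_real r * q * inverse (u x)) - u x * f (of_real r * q * u x)))"
  have F_eq: "exp (- 2 * \<i> * of_real x) * of_real (cot x) *
            (f (of_real r * q * exp (- 2 * \<i> * of_real x))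
             - exp (4 * \<i> * of_real x) * f (of_real r * q * exp (2 * \<i> * of_real x))) = F r x" for r x
  proof -
    have expand: "I * K * (P - U * Q) = K * (I * P - (I * U) * Q)" for I K P Q U :: complex
      by (simp add: algebra_simps)
    have "inverse (u x) * u x ^ 2 = u x" using nu(3) by (simp add: power2_eq_square)
    moreover have "exp (2 * \<i> * of_real x) = u x" by (simp add: u_def)
    ultimately show ?thesis
      unfolding u F_def by (simp only: expand)
  qed
  \<comment> \<open>any sequence in \<open>[0, 1)\<close> with limit \<open>1\<close> would do\<close>
  define r where "r = (\<lambda>k. real k / real (Suc k))"
  have r: "0 \<le> r k" "r k < 1" for k by (auto simp: r_def)
  have rlim: "r \<longlonglongrightarrow> 1" unfolding r_def by (rule LIMSEQ_n_over_Suc_n)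
  have flim: "(\<lambda>k. f (of_real (r k) * q * w)) \<longlonglongrightarrow> f (q * w)" if w: "norm w = 1" "q * w \<noteq> 1" for w
  proof -
    have "q * w \<in> slit_plane" using w q by (intro unit_circle_in_slit) (auto simp: norm_mult)
    then have "isCont f (q * w)"
      using f open_slit holomorphic_on_imp_continuous_on continuous_on_eq_continuous_at by blast
    moreover have "(\<lambda>k. of_real (r k) * q * w) \<longlonglongrightarrow> of_real 1 * q * w"
      by (intro tendsto_intros rlim)
    ultimately show ?thesis by (auto intro: isCont_tendsto_compose)
  qed
  define G where "G = (\<lambda>r x. if x \<in> X then 0 else F r x)"
  define g where "g = (\<lambda>x. 4 * M + 2 * C / \<eta> *
      (\<bar>cos x\<bar> * norm (1 - q * u x) powr (- p) + \<bar>cos x\<bar> * norm (1 - q * inverse (u x)) powr (- p)))"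
  have "(G 1 has_integral (- 2 * \<i> * of_real pi * f q)) {0..pi}"
  proof (rule has_integral_dominated_convergence)
    fix k
    have "((\<lambda>x::real. exp (- 2 * \<i> * of_real x) * of_real (cot x) *
            (f (of_real (r k) * q * exp (- 2 * \<i> * of_real x))
             - exp (4 * \<i> * of_real x) * f (of_real (r k) * q * exp (2 * \<i> * of_real x))))
          has_integral (- 2 * \<i> * of_real pi * f (of_real (r k) * q))) {0..pi}"
      using holomorphic_on_subset[OF f ball_subset_slit] q r[of k]
      by (intro has_integral_cot_inside_disc) (auto simp: norm_mult)
    then show "(G (r k) has_integral (- 2 * \<i> * of_real pi * f (of_real (r k) * q))) {0..pi}"
      unfolding F_eq using \<open>finite X\<close> by (rule has_integral_spike_finite[rotated 2]) (auto simp: G_def)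
    show "\<forall>x\<in>{0..pi}. norm (G (r k) x) \<le> g x"
    proof
      fix x :: real assume x: "x \<in> {0..pi}"
      have pos: "0 \<le> 2 * C / \<eta> * (\<bar>cos x\<bar> * norm (1 - q * u x) powr (- p) + \<bar>cos x\<bar> * norm (1 - q * inverse (u x)) powr (- p))"
        using C \<eta> by auto
      show "norm (G (r k) x) \<le> g x"
      proof (cases "x \<in> X \<or> sin x = 0")
        case True
        then show ?thesis using pos \<eta> by (auto simp: G_def F_def g_def cot_def)
      next
        case False
        then have s: "\<bar>sin x\<bar> > 0" and ne: "q * u x \<noteq> 1" "q * inverse (u x) \<noteq> 1"
          using x by (auto simp: X_def)
        have cot: "\<bar>cot x\<bar> = \<bar>cos x\<bar> / \<bar>sin x\<bar>" by (simp add: cot_def)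
        have nG: "norm (G (r k) x) = \<bar>cot x\<bar> *
          norm (inverse (u x) * f (of_real (r k) * q * inverse (u x)) - u x * f (of_real (r k) * q * u x))"
          using False by (simp add: G_def F_def norm_mult)
        show ?thesis
        proof (cases "2 * \<bar>sin x\<bar> \<le> \<eta>")
          case True
          have u1: "norm (u x - 1) = 2 * \<bar>sin x\<bar>"
            using dist_exp_i_1[of "2 * x"] by (simp add: u_def mult_ac)
          have u2: "norm (inverse (u x) - 1) = 2 * \<bar>sin x\<bar>"
            using dist_exp_i_1[of "2 * (- x)"] by (simp add: u_def exp_minus[symmetric] mult_ac)
          have "norm (inverse (u x) - u x) \<le> norm (inverse (u x) - 1) + norm (u x - 1)"
            by (metis dist_norm dist_triangle2)
          also have "\<dots> = 4 * \<bar>sin x\<bar>" using u1 u2 by simp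
          finally have "M * norm (inverse (u x) - u x) \<le> M * (4 * \<bar>sin x\<bar>)"
            using \<eta> by (intro mult_left_mono)
          then have "norm (G (r k) x) \<le> \<bar>cot x\<bar> * (M * (4 * \<bar>sin x\<bar>))"
            unfolding nG using lip[of "r k" "inverse (u x)" "u x"] r[of k] nu u1 u2 True
            by (intro mult_left_mono) auto
          also have "\<dots> = 4 * M * \<bar>cos x\<bar>" using s by (simp add: cot)
          also have "\<dots> \<le> 4 * M * 1" using \<eta> by (intro mult_left_mono) auto
          finally show ?thesis using pos by (simp add: g_def)
        next
          case False
          have "\<bar>cot x\<bar> \<le> 2 / \<eta> * \<bar>cos x\<bar>"
            using False \<eta> s by (simp add: cot field_simps) (metis abs_ge_zero linear mult.commute mult_left_mono)
          moreover have "norm (inverse (u x) * f (of_real (r k) * q * inverse (u x)) - u x * f (of_real (r k) * q * u x))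
              \<le> C * norm (1 - q * inverse (u x)) powr (- p) + C * norm (1 - q * u x) powr (- p)"
          proof (intro order_trans[OF norm_triangle_ineq4] add_mono)
            show "norm (inverse (u x) * f (of_real (r k) * q * inverse (u x))) \<le> C * norm (1 - q * inverse (u x)) powr (- p)"
              using C(2)[of "q * inverse (u x)" "r k"] ne q r[of k] nu by (simp add: norm_mult mult.assoc)
            show "norm (u x * f (of_real (r k) * q * u x)) \<le> C * norm (1 - q * u x) powr (- p)"
              using C(2)[of "q * u x" "r k"] ne q r[of k] nu by (simp add: norm_mult mult.assoc)
          qed
          ultimately have "norm (G (r k) x) \<le> 2 / \<eta> * \<bar>cos x\<bar> *
             (C * norm (1 - q * inverse (u x)) powr (- p) + C * norm (1 - q * u x) powr (- p))"
            unfolding nG using \<eta> by (intro mult_mono) auto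
          also have "\<dots> = 2 * C / \<eta> *
      (\<bar>cos x\<bar> * norm (1 - q * u x) powr (- p) + \<bar>cos x\<bar> * norm (1 - q * inverse (u x)) powr (- p))"
            by (simp add: field_simps)
          also have "\<dots> \<le> g x" using \<eta> by (simp add: g_def)
          finally show ?thesis .
        qed
      qed
    qed
  next
    have "(\<lambda>x. \<bar>cos x\<bar> * norm (1 - q * u x) powr (- p)) integrable_on {0..pi}"
      "(\<lambda>x. \<bar>cos x\<bar> * norm (1 - q * inverse (u x)) powr (- p)) integrable_on {0..pi}"
      using cos_chord_powr_integrable[OF q(1) _ p, of 1] cos_chord_powr_integrable[OF q(1) _ p, of "-1"]
      by (simp_all only: ue simp_thms)
    then show "g integrable_on {0..pi}"
      unfolding g_def by (intro integrable_add integrable_on_mult_right) auto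
    show "\<forall>x\<in>{0..pi}. (\<lambda>k. G (r k) x) \<longlonglongrightarrow> G 1 x"
    proof
      fix x :: real assume x: "x \<in> {0..pi}"
      show "(\<lambda>k. G (r k) x) \<longlonglongrightarrow> G 1 x"
      proof (cases "x \<in> X")
        case False
        then have ne: "q * u x \<noteq> 1" "q * inverse (u x) \<noteq> 1" using x by (auto simp: X_def)
        have "(\<lambda>k. F (r k) x) \<longlonglongrightarrow> of_real (cot x) *
            (inverse (u x) * f (q * inverse (u x)) - u x * f (q * u x))"
          unfolding F_def by (intro tendsto_intros flim nu ne)
        then show ?thesis using False by (simp add: G_def F_def)
      qed (simp add: G_def)
    qed
    have "(\<lambda>k. f (of_real (r k) * q * 1)) \<longlonglongrightarrow> f (q * 1)"
      by (rule flim) (use q in auto)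
    then show "(\<lambda>k. - 2 * \<i> * of_real pi * f (of_real (r k) * q)) \<longlonglongrightarrow> - 2 * \<i> * of_real pi * f q"
      by (intro tendsto_intros) simp
  qed
  then have "(F 1 has_integral (- 2 * \<i> * of_real pi * f q)) {0..pi}"
    using \<open>finite X\<close> by (rule has_integral_spike_finite[rotated 2]) (auto simp: G_def)
  then show ?thesis unfolding F_eq[of _ 1, symmetric] by simp
qed

section \<open>The integral of the Lerch function\<close>

lemma has_integral_cot_lerch_series:
  assumes e: "0 < e" "e \<le> 1"
    and summ: "summable (\<lambda>n. norm (lerch_coeff s v n) * norm q ^ n * real (Suc n) powr e)"
    and series: "\<And>z. norm z = norm q \<Longrightarrow> hurwitz_lerch z s v = lerch_series z s v"
  shows "((\<lambda>x::real. exp (- 2 * \<i> * of_real x) * of_real (cot x) *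
            (hurwitz_lerch (q * exp (- 2 * \<i> * of_real x)) s v
             - exp (4 * \<i> * of_real x) * hurwitz_lerch (q * exp (2 * \<i> * of_real x)) s v))
          has_integral (- 2 * \<i> * of_real pi * hurwitz_lerch q s v)) {0..pi}"
proof -
  have eq: "hurwitz_lerch (q * w) s v = (\<Sum>n. (lerch_coeff s v n * q ^ n) * w ^ n)" if "norm w = 1" for w
    using series[of "q * w"] that by (simp add: norm_mult lerch_series_eq power_mult_distrib mult.assoc)
  have "summable (\<lambda>n. norm (lerch_coeff s v n * q ^ n) * real (Suc n) powr e)"
    using summ by (simp only: norm_mult norm_power)
  from has_integral_cot_fourier_series[OF e this]
  have "((\<lambda>x::real. exp (- 2 * \<i> * of_real x) * of_real (cot x) *
            ((\<Sum>n. (lerch_coeff s v n * q ^ n) * exp (- 2 * \<i> * of_real x) ^ n)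
             - exp (4 * \<i> * of_real x) * (\<Sum>n. (lerch_coeff s v n * q ^ n) * exp (2 * \<i> * of_real x) ^ n)))
          has_integral (- 2 * \<i> * of_real pi * (\<Sum>n. lerch_coeff s v n * q ^ n))) {0..pi}" .
  moreover have "(\<Sum>n. (lerch_coeff s v n * q ^ n) * exp (- 2 * \<i> * of_real x) ^ n)
        = hurwitz_lerch (q * exp (- 2 * \<i> * of_real x)) s v"
    "(\<Sum>n. (lerch_coeff s v n * q ^ n) * exp (2 * \<i> * of_real x) ^ n)
        = hurwitz_lerch (q * exp (2 * \<i> * of_real x)) s v" for x :: real
    by (intro eq[symmetric]; simp)+
  moreover have "(\<Sum>n. lerch_coeff s v n * q ^ n) = hurwitz_lerch q s v"
    using eq[of 1] by simp
  ultimately show ?thesis by (simp only:)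
qed

lemma has_integral_cot_lerch_boundary:
  assumes q: "norm q = 1" "q \<noteq> 1" and s: "- 1 < Re s" "Re s \<le> 1" and s': "q = - 1 \<or> Re s > 0"
  shows "((\<lambda>x::real. exp (- 2 * \<i> * of_real x) * of_real (cot x) *
            (hurwitz_lerch (q * exp (- 2 * \<i> * of_real x)) s v
             - exp (4 * \<i> * of_real x) * hurwitz_lerch (q * exp (2 * \<i> * of_real x)) s v))
          has_integral (- 2 * \<i> * of_real pi * hurwitz_lerch q s v)) {0..pi}"
proof -
  obtain f where f: "f holomorphic_on slit_plane" "\<And>z. norm z < 1 \<Longrightarrow> f z = lerch_series z s v"
    and bound: "\<And>p. 0 < p \<Longrightarrow> p < 2 \<Longrightarrow> 1 - Re s < p \<Longrightarrow>
        \<exists>C\<ge>0. \<forall>z r. norm z = 1 \<longrightarrow> z \<noteq> 1 \<longrightarrow> 0 \<le> r \<longrightarrow> r \<le> 1 \<longrightarrow>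
           norm (f (of_real r * z)) \<le> C * norm (1 - z) powr (- p)"
    using lerch_series_continuation[OF s(1)] by metis
  have hl: "hurwitz_lerch z s v = f z" if "norm z = 1" "z \<noteq> 1" for z
    by (rule hurwitz_lerch_eq_continuation[OF f unit_circle_in_slit[OF that] s(2)])
  \<comment> \<open>\<open>p\<close> has to lie between \<open>1 - Re s\<close> and \<open>1\<close>, or between \<open>1 - Re s\<close> and \<open>2\<close> if \<open>Re s \<le> 0\<close>\<close>
  define p where "p = (if Re s > 0 then 1 - Re s / 2 else (3 - Re s) / 2)"
  have p: "0 < p" "p < 2" "1 - Re s < p" and p1: "p < 1 \<or> (q = - 1 \<and> p < 2)"
    using s s' by (auto simp: p_def field_simps)
  obtain C where C: "C \<ge> 0" "\<And>z r. norm z = 1 \<Longrightarrow> z \<noteq> 1 \<Longrightarrow> 0 \<le> r \<Longrightarrow> r \<le> 1 \<Longrightarrow>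
           norm (f (of_real r * z)) \<le> C * norm (1 - z) powr (- p)"
    using bound[OF p] by blast
  \<comment> \<open>the points where an argument is \<open>1\<close>, so that the Lerch function is unspecified there\<close>
  let ?X = "{x \<in> {0..pi}. q * exp (of_real 1 * (2 * \<i> * of_real x)) = 1}
     \<union> {x \<in> {0..pi}. q * exp (of_real (-1) * (2 * \<i> * of_real x)) = 1}"
  have fin: "finite ?X"
    using finite_zeros_rotation[OF q(1), of 1] finite_zeros_rotation[OF q(1), of "-1"] by blast
  have int: "((\<lambda>x::real. exp (- 2 * \<i> * of_real x) * of_real (cot x) *
            (f (q * exp (- 2 * \<i> * of_real x))
             - exp (4 * \<i> * of_real x) * f (q * exp (2 * \<i> * of_real x))))
          has_integral (- 2 * \<i> * of_real pi * f q)) {0..pi}"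
    by (rule has_integral_cot_boundary[OF f(1) q C less_imp_le[OF p(1)] p1])
  have "((\<lambda>x::real. exp (- 2 * \<i> * of_real x) * of_real (cot x) *
            (hurwitz_lerch (q * exp (- 2 * \<i> * of_real x)) s v
             - exp (4 * \<i> * of_real x) * hurwitz_lerch (q * exp (2 * \<i> * of_real x)) s v))
          has_integral (- 2 * \<i> * of_real pi * f q)) {0..pi}"
  proof (rule has_integral_spike_finite[OF fin _ int])
    fix x :: real assume "x \<in> {0..pi} - ?X"
    then have "q * exp (- 2 * \<i> * of_real x) \<noteq> 1" "q * exp (2 * \<i> * of_real x) \<noteq> 1" by auto
    moreover have "norm (q * exp (- 2 * \<i> * of_real x)) = 1" "norm (q * exp (2 * \<i> * of_real x)) = 1"
      using q by (simp_all add: norm_mult)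
    ultimately have "hurwitz_lerch (q * exp (- 2 * \<i> * of_real x)) s v = f (q * exp (- 2 * \<i> * of_real x))"
      "hurwitz_lerch (q * exp (2 * \<i> * of_real x)) s v = f (q * exp (2 * \<i> * of_real x))"
      by (auto intro: hl)
    then show "exp (- 2 * \<i> * of_real x) * of_real (cot x) *
            (hurwitz_lerch (q * exp (- 2 * \<i> * of_real x)) s v
             - exp (4 * \<i> * of_real x) * hurwitz_lerch (q * exp (2 * \<i> * of_real x)) s v)
        = exp (- 2 * \<i> * of_real x) * of_real (cot x) *
            (f (q * exp (- 2 * \<i> * of_real x))
             - exp (4 * \<i> * of_real x) * f (q * exp (2 * \<i> * of_real x)))"
      by (simp only:)
  qed
  then show ?thesis by (simp only: hl[OF q])
qed

theorem theorem4p36: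
  fixes k a m :: complex
  assumes "lerch_params (- k) a"
    and "Re m > 0 \<or>
         (Re m = 0 \<and> (if exp (- 2 * m) = 1 then Re k < - 1
                       else if exp (- 2 * m) = - 1 then Re k < 1
                       else Re k < 0))"
  shows "((\<lambda>x::real. exp (- 2 * \<i> * of_real x) * of_real (cot x) *
            (hurwitz_lerch (exp (- 2 * (m + \<i> * of_real x))) (- k) a
             - exp (4 * \<i> * of_real x) *
               hurwitz_lerch (exp (- 2 * m + 2 * \<i> * of_real x)) (- k) a))
          has_integral (- 2 * \<i> * of_real pi * hurwitz_lerch (exp (- 2 * m)) (- k) a)) {0..pi}"
proof -
  define q where "q = exp (- 2 * m)"
  define s where "s = - k"
  have nq: "norm q = exp (- 2 * Re m)" by (simp add: q_def)
  have "((\<lambda>x::real. exp (- 2 * \<i> * of_real x) * of_real (cot x) *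
            (hurwitz_lerch (q * exp (- 2 * \<i> * of_real x)) s a
             - exp (4 * \<i> * of_real x) * hurwitz_lerch (q * exp (2 * \<i> * of_real x)) s a))
          has_integral (- 2 * \<i> * of_real pi * hurwitz_lerch q s a)) {0..pi}"
  proof (cases "Re m > 0")
    case True
    then have "0 < norm q" "norm q < 1" by (auto simp: nq)
    then show ?thesis
      by (intro has_integral_cot_lerch_series[of 1] lerch_coeff_summable_inside) (auto simp: hurwitz_lerch_def)
  next
    case False
    then have m: "Re m = 0" and k: "if q = 1 then Re s > 1 else if q = - 1 then Re s > - 1 else Re s > 0"
      using assms(2) by (auto simp: q_def s_def split: if_splits)
    have q1: "norm q = 1" using m by (simp add: nq)
    show ?thesis
    proof (cases "Re s > 1")
      case True
      define e where "e = min 1 ((Re s - 1) / 2)"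
      have e: "0 < e" "e \<le> 1" "e < Re s - 1" using True by (auto simp: e_def min_def)
      show ?thesis
        using True q1 lerch_coeff_summable_boundary[OF e(1,3), of a]
        by (intro has_integral_cot_lerch_series[OF e(1,2)]) (auto simp: hurwitz_lerch_def)
    next
      case False
      then have "q \<noteq> 1" "- 1 < Re s" "Re s \<le> 1" "q = - 1 \<or> Re s > 0"
        using k by (auto split: if_splits)
      then show ?thesis by (intro has_integral_cot_lerch_boundary q1)
    qed
  qed
  moreover have "exp (- 2 * (m + \<i> * of_real x)) = q * exp (- 2 * \<i> * of_real x)"
    "exp (- 2 * m + 2 * \<i> * of_real x) = q * exp (2 * \<i> * of_real x)" for x :: real
    by (simp_all add: q_def exp_add[symmetric] algebra_simps)
  ultimately show ?thesis by (simp only: q_def s_def)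
qed

end
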